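(* Let $n\ge 3$ and let $x\in S^n$ be a $\frac12$-integer point with support graph $G_x$. Suppose that (A) $G_x$ has a Hamiltonian cycle $H$, and (B) $x$ is a convex combination of incidence vectors of $1$-trees of $K_n$ each of which contains an even number of edges of every cut $\delta_{G_x}(S)$ ($\emptyset\ne S\subsetneq V_n$) of $G_x$ that consists of exactly four $\frac12$-edges, all belonging to $H$. Then $\frac{10}{7}x\in T^n$.
   Context: $K_n=(V_n,E_n)$ is the complete graph on $n$ nodes, one of which is labelled $1$. For $U\subseteq V_n$, $\delta(U)$ is the set of edges with exactly one endpoint in $U$ (and $\delta_{G}(U)$ the same within a graph $G$), $x(F)=\sum_{e\in F}x_e$. $S^n=\{x\in\mathbb{R}^{E_n}: x(\delta(v))=2 \ \forall v,\ x(\delta(S))\ge 2\ \forall \emptyset\ne S\subsetneq V_n,\ 0\le x\le 1\}$. The support graph of $x$ is $G_x=(V_n,\{e: x_e>0\})$. A point $x\in S^n$ is $\frac12$-integer if $x_e\in\{0,\frac12,1\}$ for all $e$; edges with $x_e=\frac12$ are $\frac12$-edges. A $1$-tree is an edge set $F\subseteq E_n$ with $|F\cap\delta(1)|=2$ such that $F\setminus\delta(1)$ is a spanning tree on $V_n\setminus\{1\}$. A tour is a multiset $J$ of edges of $K_n$ such that $(V_n,J)$ is connected with all degrees even; $\chi^J$ records multiplicities; $T^n$ is the convex hull of incidence vectors of all tours of $K_n$. *)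

theory Defs
  imports "HOL-Analysis.Analysis" "HOL-Library.Function_Algebras" "HOL-Library.Multiset"
begin

text \<open>Pointwise vector space structure on functions, so that the library's \<open>convex hull\<close>
  applies to functions from edges to reals.\<close>

instantiation "fun" :: (type, real_vector) real_vector
begin

definition scaleR_fun :: "real \<Rightarrow> ('a \<Rightarrow> 'b) \<Rightarrow> 'a \<Rightarrow> 'b"
  where "scaleR_fun r f = (\<lambda>a. r *\<^sub>R f a)"

instance
  by standard (auto simp: scaleR_fun_def fun_eq_iff scaleR_add_right scaleR_add_left)

end

lemma scaleR_fun_apply [simp]: "(r *\<^sub>R f) a = r *\<^sub>R f a"
  by (simp add: scaleR_fun_def)

text \<open>A simple graph is given by a vertex set and a set of edges, an edge being a set of two
  vertices.\<close>

definition complete_edges :: "'a set \<Rightarrow> 'a set set"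
  where "complete_edges V = {e. e \<subseteq> V \<and> card e = 2}"

definition V\<^sub>K :: "nat \<Rightarrow> nat set"
  where "V\<^sub>K n = {1..n}"

definition E\<^sub>K :: "nat \<Rightarrow> nat set set"
  where "E\<^sub>K n = complete_edges (V\<^sub>K n)"

text \<open>\<open>cut_edges E U\<close> is \<open>\<delta>\<^sub>G(U)\<close> for a graph \<open>G\<close> with edge set \<open>E\<close>.\<close>

definition cut_edges :: "'a set set \<Rightarrow> 'a set \<Rightarrow> 'a set set"
  where "cut_edges E U = {e \<in> E. card (e \<inter> U) = 1}"

definition connected_graph :: "'a set \<Rightarrow> 'a set set \<Rightarrow> bool"
  where "connected_graph V E \<longleftrightarrow> (\<forall>u\<in>V. \<forall>v\<in>V. (u, v) \<in> {(a, b). {a, b} \<in> E}\<^sup>*)"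

text \<open>The edges of the closed walk visiting the listed vertices in order.\<close>

definition closed_walk_edges :: "'a list \<Rightarrow> 'a set set"
  where "closed_walk_edges vs = {{vs ! i, vs ! (Suc i mod length vs)} | i. i < length vs}"

definition cycle_in :: "'a set set \<Rightarrow> 'a list \<Rightarrow> bool"
  where "cycle_in E vs \<longleftrightarrow> 3 \<le> length vs \<and> distinct vs \<and> closed_walk_edges vs \<subseteq> E"

definition hamiltonian_cycle :: "'a set \<Rightarrow> 'a set set \<Rightarrow> 'a set set \<Rightarrow> bool"
  where "hamiltonian_cycle V E H \<longleftrightarrow>
    (\<exists>vs. cycle_in E vs \<and> set vs = V \<and> H = closed_walk_edges vs)"

definition spanning_tree_on :: "'a set \<Rightarrow> 'a set set \<Rightarrow> bool"
  where "spanning_tree_on V T \<longleftrightarrow>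
    T \<subseteq> complete_edges V \<and> connected_graph V T \<and> (\<nexists>vs. cycle_in T vs)"

definition one_tree :: "nat \<Rightarrow> nat set set \<Rightarrow> bool"
  where "one_tree n F \<longleftrightarrow>
    F \<subseteq> E\<^sub>K n \<and> card (F \<inter> cut_edges (E\<^sub>K n) {1}) = 2 \<and>
    spanning_tree_on (V\<^sub>K n - {1}) (F - cut_edges (E\<^sub>K n) {1})"

text \<open>Vectors indexed by \<open>E\<^sub>K n\<close> are represented as functions on all sets of naturals that
  vanish outside \<open>E\<^sub>K n\<close>.\<close>

definition S_polytope :: "nat \<Rightarrow> (nat set \<Rightarrow> real) set"
  where "S_polytope n = {x.
    (\<forall>e. e \<notin> E\<^sub>K n \<longrightarrow> x e = 0) \<and>
    (\<forall>v\<in>V\<^sub>K n. sum x (cut_edges (E\<^sub>K n) {v}) = 2) \<and>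
    (\<forall>S. S \<noteq> {} \<and> S \<subset> V\<^sub>K n \<longrightarrow> sum x (cut_edges (E\<^sub>K n) S) \<ge> 2) \<and>
    (\<forall>e\<in>E\<^sub>K n. 0 \<le> x e \<and> x e \<le> 1)}"

definition support_edges :: "nat \<Rightarrow> (nat set \<Rightarrow> real) \<Rightarrow> nat set set"
  where "support_edges n x = {e \<in> E\<^sub>K n. x e > 0}"

definition half_integer :: "nat \<Rightarrow> (nat set \<Rightarrow> real) \<Rightarrow> bool"
  where "half_integer n x \<longleftrightarrow> (\<forall>e\<in>E\<^sub>K n. x e \<in> {0, 1/2, 1})"

definition tour :: "nat \<Rightarrow> nat set multiset \<Rightarrow> bool"
  where "tour n J \<longleftrightarrow>
    set_mset J \<subseteq> E\<^sub>K n \<and> connected_graph (V\<^sub>K n) (set_mset J) \<and>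
    (\<forall>v\<in>V\<^sub>K n. even (size {#e \<in># J. v \<in> e#}))"

definition multi_incidence :: "'a set multiset \<Rightarrow> 'a set \<Rightarrow> real"
  where "multi_incidence J = (\<lambda>e. real (count J e))"

definition T_polyhedron :: "nat \<Rightarrow> (nat set \<Rightarrow> real) set"
  where "T_polyhedron n = convex hull {multi_incidence J | J. tour n J}"

end

theory Submission
  imports Defs
begin

text \<open>
  Let \<open>y = (2/3) x - (1/6) \<chi>\<^sup>H\<close>. A cut of the support graph has an even number \<open>h\<close> of edges in \<open>H\<close>
  and value \<open>y(\<delta>(S)) = (2/3) x(\<delta>(S)) - h/6\<close>, which is at least 1 unless the cut consists of exactly
  four half-edges of \<open>H\<close>. By hypothesis the latter cuts meet each 1-tree \<open>F\<close> evenly, so \<open>y\<close> covers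
  every cut that \<open>F\<close> meets oddly. By the Edmonds--Johnson theorem \<open>y\<close> dominates a convex combination
  of edge sets \<open>J\<close> with the same odd-degree vertices as \<open>F\<close>; each \<open>F + J\<close> is a tour, and averaging
  over the 1-trees gives \<open>x + y \<in> T\<^sup>n\<close>. Finally \<open>(10/7) x = (6/7) (x + y) + (1/7) \<chi>\<^sup>H\<close>.

  The Edmonds--Johnson theorem is obtained from the inequality "minimum weight of a \<open>T\<close>-join is at
  most \<open>w \<cdot> y\<close>" for all weights \<open>w \<ge> 0\<close>. For integral weights that are even on all cycles this goes by
  induction on the total weight: some \<open>T\<close>-odd cut of positive edges can be lowered by 1 so that the
  minimum drops by at most 1.
\<close>

subsection \<open>Odd-degree vertices and joins\<close>

definition odd_vertices :: "'a set set \<Rightarrow> 'a set"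
  where "odd_vertices X = {v. odd (card {e \<in> X. v \<in> e})}"

definition joins :: "'a set set \<Rightarrow> 'a set \<Rightarrow> 'a set set set"
  where "joins E T = {J. J \<subseteq> E \<and> odd_vertices J = T}"

lemma joinsI: "J \<subseteq> E \<Longrightarrow> odd_vertices J = T \<Longrightarrow> J \<in> joins E T"
  by (simp add: joins_def)

lemma joinsD:
  assumes "J \<in> joins E T"
  shows joins_subset: "J \<subseteq> E" and joins_odd_vertices: "odd_vertices J = T"
  using assms by (simp_all add: joins_def)

lemma sum_sym_diff_plus_Int:
  fixes f :: "'a \<Rightarrow> 'b::comm_semiring_1"
  assumes "finite A" "finite B"
  shows "sum f (sym_diff A B) + 2 * sum f (A \<inter> B) = sum f A + sum f B"
proof -
  have "sum f (sym_diff A B) = sum f (A - B) + sum f (B - A)"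
    using assms by (intro sum.union_disjoint) auto
  moreover have "sum f A = sum f (A \<inter> B) + sum f (A - B)"
    using assms by (simp add: sum.Int_Diff)
  moreover have "sum f B = sum f (A \<inter> B) + sum f (B - A)"
    using assms by (metis sum.Int_Diff Int_commute)
  ultimately show ?thesis by (simp add: algebra_simps mult_2)
qed

lemma even_sum_sym_diff:
  fixes f :: "'a \<Rightarrow> nat"
  assumes "finite A" "finite B"
  shows "even (sum f (sym_diff A B)) \<longleftrightarrow> even (sum f A + sum f B)"
  by (simp flip: sum_sym_diff_plus_Int[OF assms])

lemma even_card_sym_diff:
  assumes "finite A" "finite B"
  shows "even (card (sym_diff A B)) \<longleftrightarrow> even (card A + card B)"
  using even_sum_sym_diff[OF assms, of "\<lambda>_. 1"] by simp

lemma even_card_sym_diff_pair: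
  assumes "finite T"
  shows "even (card (sym_diff T (sym_diff {a} {b}))) \<longleftrightarrow> even (card T)"
  using even_card_sym_diff[OF assms, of "sym_diff {a} {b}"] even_card_sym_diff[of "{a}" "{b}"]
  by simp

lemma odd_vertices_sym_diff:
  assumes "finite X" "finite Y"
  shows "odd_vertices (sym_diff X Y) = sym_diff (odd_vertices X) (odd_vertices Y)"
proof -
  have "{e \<in> sym_diff X Y. v \<in> e} = sym_diff {e \<in> X. v \<in> e} {e \<in> Y. v \<in> e}" for v by auto
  then have "odd (card {e \<in> sym_diff X Y. v \<in> e}) \<longleftrightarrow>
      odd (card {e \<in> X. v \<in> e}) \<noteq> odd (card {e \<in> Y. v \<in> e})" for v
    using even_card_sym_diff[of "{e \<in> X. v \<in> e}" "{e \<in> Y. v \<in> e}"] assms by simp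
  then show ?thesis unfolding odd_vertices_def by auto
qed

lemma odd_vertices_empty [simp]: "odd_vertices {} = {}"
  by (simp add: odd_vertices_def)

lemma odd_vertices_singleton [simp]: "odd_vertices {e} = e"
proof -
  have "{d \<in> {e}. v \<in> d} = (if v \<in> e then {e} else {})" for v by auto
  then show ?thesis by (auto simp: odd_vertices_def)
qed

lemma odd_vertices_insert:
  assumes "finite X" "e \<notin> X"
  shows "odd_vertices (insert e X) = sym_diff (odd_vertices X) e"
proof -
  have "insert e X = sym_diff X {e}" using assms by auto
  then show ?thesis using odd_vertices_sym_diff[of X "{e}"] assms by simp
qed

lemma odd_vertices_Diff:
  assumes "finite X" "Y \<subseteq> X"
  shows "odd_vertices (X - Y) = sym_diff (odd_vertices X) (odd_vertices Y)"
proof -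
  have "X - Y = sym_diff X Y" using assms by auto
  then show ?thesis using odd_vertices_sym_diff[of X Y] assms finite_subset by metis
qed

lemma odd_vertices_subset_Union: "odd_vertices X \<subseteq> \<Union>X"
proof
  fix v assume "v \<in> odd_vertices X"
  then have "{e \<in> X. v \<in> e} \<noteq> {}"
    by (auto simp: odd_vertices_def simp del: Collect_empty_eq)
  then show "v \<in> \<Union>X" by auto
qed

subsection \<open>Cuts\<close>

lemma cut_edges_mono: "X \<subseteq> Y \<Longrightarrow> cut_edges X S \<subseteq> cut_edges Y S"
  by (auto simp: cut_edges_def)

lemma cut_edges_subset: "cut_edges X S \<subseteq> X"
  by (auto simp: cut_edges_def)

lemma finite_cut_edges: "finite X \<Longrightarrow> finite (cut_edges X S)"
  by (simp add: cut_edges_def)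

lemma cut_edges_Int_right: "X \<subseteq> Y \<Longrightarrow> X \<inter> cut_edges Y S = cut_edges X S"
  by (auto simp: cut_edges_def)

lemma cut_edges_Diff: "cut_edges (X - Y) S = cut_edges X S - cut_edges Y S"
  by (auto simp: cut_edges_def)

lemma cut_edges_sym_diff: "cut_edges (sym_diff X Y) S = sym_diff (cut_edges X S) (cut_edges Y S)"
  by (auto simp: cut_edges_def)

lemma cut_edges_empty [simp]: "cut_edges {} S = {}"
  by (simp add: cut_edges_def)

lemma cut_edges_insert:
  "cut_edges (insert e X) S =
    (if card (e \<inter> S) = 1 then insert e (cut_edges X S) else cut_edges X S)"
  by (auto simp: cut_edges_def)

lemma cut_edgesI: "{a, b} \<in> X \<Longrightarrow> a \<in> S \<Longrightarrow> b \<notin> S \<Longrightarrow> {a, b} \<in> cut_edges X S"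
  by (simp add: cut_edges_def Int_insert_left)

lemma card_cut_edges_Diff:
  assumes "finite X" "Y \<subseteq> X"
  shows "card (cut_edges X S) = card (cut_edges (X - Y) S) + card (cut_edges Y S)"
proof -
  have "cut_edges Y S \<subseteq> cut_edges X S" using cut_edges_mono[OF assms(2)] .
  then show ?thesis
    using finite_cut_edges[OF assms(1), of S] finite_subset card_mono
    by (fastforce simp: cut_edges_Diff card_Diff_subset)
qed

subsection \<open>Reachability\<close>

definition reachable :: "'a set set \<Rightarrow> 'a \<Rightarrow> 'a \<Rightarrow> bool"
  where "reachable E a b \<longleftrightarrow> (a, b) \<in> {(a, b). {a, b} \<in> E}\<^sup>*"

definition component :: "'a set set \<Rightarrow> 'a \<Rightarrow> 'a set"
  where "component E a = {b. reachable E a b}"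

lemma reachable_refl [simp]: "reachable E a a"
  by (simp add: reachable_def)

lemma reachable_step: "reachable E a b \<Longrightarrow> {b, c} \<in> E \<Longrightarrow> reachable E a c"
  unfolding reachable_def by (auto intro: rtrancl_into_rtrancl)

lemma reachable_trans: "reachable E a b \<Longrightarrow> reachable E b c \<Longrightarrow> reachable E a c"
  unfolding reachable_def by (rule rtrancl_trans)

lemma reachable_sym:
  assumes "reachable E a b"
  shows "reachable E b a"
proof -
  have "sym ({(a, b). {a, b} \<in> E}\<^sup>*)"
    by (intro sym_rtrancl) (auto simp: sym_def insert_commute)
  then show ?thesis using assms unfolding reachable_def by (rule symD)
qed

lemma reachable_induct [consumes 1, case_names refl step]:
  assumes "reachable E a b"
    and "P a"
    and "\<And>b c. reachable E a b \<Longrightarrow> {b, c} \<in> E \<Longrightarrow> P b \<Longrightarrow> P c"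
  shows "P b"
  using assms unfolding reachable_def by (induction rule: rtrancl_induct) auto

lemma connected_graph_iff_reachable: "connected_graph V E \<longleftrightarrow> (\<forall>u\<in>V. \<forall>v\<in>V. reachable E u v)"
  by (simp add: connected_graph_def reachable_def)

lemma connected_graphI_root:
  assumes "\<And>v. v \<in> V \<Longrightarrow> reachable E r v"
  shows "connected_graph V E"
  unfolding connected_graph_iff_reachable using assms reachable_sym reachable_trans by metis

lemma connected_graph_mono:
  assumes "connected_graph V E" "E \<subseteq> E'"
  shows "connected_graph V E'"
proof -
  have "{(a, b). {a, b} \<in> E}\<^sup>* \<subseteq> {(a, b). {a, b} \<in> E'}\<^sup>*"
    using assms(2) by (intro rtrancl_mono) auto
  then show ?thesis using assms(1) unfolding connected_graph_def by blast
qed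

lemma root_in_component [simp]: "a \<in> component E a"
  by (simp add: component_def)

lemma component_subset_insert_Union: "component E a \<subseteq> insert a (\<Union>E)"
proof
  fix b assume "b \<in> component E a"
  then have "reachable E a b" by (simp add: component_def)
  then show "b \<in> insert a (\<Union>E)" by (induction rule: reachable_induct) auto
qed

subsection \<open>Finite graphs\<close>

locale finite_graph =
  fixes V :: "'a set" and E :: "'a set set"
  assumes finite_V: "finite V" and E_subset: "E \<subseteq> complete_edges V"
begin

lemma finite_E: "finite E"
proof (rule finite_subset[OF E_subset])
  show "finite (complete_edges V)" using finite_V by (simp add: complete_edges_def)
qed

lemma finite_edges: "X \<subseteq> E \<Longrightarrow> finite X"
  using finite_E finite_subset by blast

lemma card_edge: "e \<in> E \<Longrightarrow> card e = 2"
  using E_subset by (auto simp: complete_edges_def)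

lemma Union_edges: "X \<subseteq> E \<Longrightarrow> \<Union>X \<subseteq> V"
  using E_subset unfolding complete_edges_def by blast

lemma cut_edgesE:
  assumes "e \<in> cut_edges X S" "X \<subseteq> E"
  obtains a b where "e = {a, b}" "a \<noteq> b" "e \<in> X" "a \<in> S" "b \<notin> S"
proof -
  have e: "e \<in> X" "card (e \<inter> S) = 1" using assms(1) by (auto simp: cut_edges_def)
  then obtain a where a: "e \<inter> S = {a}" by (auto simp: card_1_singleton_iff)
  then have "a \<in> e" by blast
  then have "card (e - {a}) = 1" using card_edge e(1) assms(2) by (simp add: subset_iff)
  then obtain b where "e - {a} = {b}" by (rule card_1_singletonE)
  then have "e = {a, b}" "a \<noteq> b" "a \<in> S" "b \<notin> S" using a by blast+
  then show thesis using that e(1) by blast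
qed

lemma odd_vertices_edges_sym_diff:
  "X \<subseteq> E \<Longrightarrow> Y \<subseteq> E \<Longrightarrow> odd_vertices (sym_diff X Y) = sym_diff (odd_vertices X) (odd_vertices Y)"
  by (rule odd_vertices_sym_diff[OF finite_edges finite_edges])

lemma odd_vertices_subset: "X \<subseteq> E \<Longrightarrow> odd_vertices X \<subseteq> V"
  using odd_vertices_subset_Union Union_edges by (rule subset_trans)

lemma finite_odd_vertices: "X \<subseteq> E \<Longrightarrow> finite (odd_vertices X)"
  using odd_vertices_subset finite_V finite_subset by blast

lemma finite_joins: "finite (joins E T)"
  using finite_E by (simp add: joins_def)

lemma even_card_Int_odd_vertices_iff:
  assumes "X \<subseteq> E"
  shows "even (card (S \<inter> odd_vertices X)) \<longleftrightarrow> even (card (cut_edges X S))"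
  using finite_edges[OF assms] assms
proof (induction X rule: finite_induct)
  case empty
  then show ?case by simp
next
  case (insert e X)
  have e: "card e = 2" using insert.prems card_edge by blast
  then have "finite e" by (simp add: card_ge_0_finite)
  have "card (e \<inter> S) \<le> 2" using card_mono[OF \<open>finite e\<close>, of "e \<inter> S"] e by auto
  then have odd_e: "even (card (S \<inter> e)) \<longleftrightarrow> card (e \<inter> S) \<noteq> 1"
    by (auto simp: Int_commute le_Suc_eq numeral_2_eq_2)
  have "S \<inter> odd_vertices (insert e X) = sym_diff (S \<inter> odd_vertices X) (S \<inter> e)"
    using odd_vertices_insert[OF insert.hyps] by auto
  then have "even (card (S \<inter> odd_vertices (insert e X))) \<longleftrightarrow>
      even (card (S \<inter> odd_vertices X) + card (S \<inter> e))"
    using even_card_sym_diff[of "S \<inter> odd_vertices X" "S \<inter> e"] \<open>finite e\<close>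
      finite_odd_vertices[of X] insert.prems by simp
  moreover have "e \<notin> cut_edges X S" "finite (cut_edges X S)"
    using insert.hyps by (auto simp: cut_edges_def)
  ultimately show ?case using insert odd_e by (auto simp: cut_edges_insert)
qed

lemma even_card_odd_vertices:
  assumes "X \<subseteq> E"
  shows "even (card (odd_vertices X))"
proof -
  have "e \<inter> V = e" if "e \<in> X" for e using Union_edges[OF assms] that by auto
  then have "cut_edges X V = {}"
    using card_edge assms by (auto simp: cut_edges_def)
  moreover have "V \<inter> odd_vertices X = odd_vertices X" using odd_vertices_subset[OF assms] by auto
  ultimately show ?thesis using even_card_Int_odd_vertices_iff[OF assms, of V] by simp
qed

lemma cut_edges_component:
  assumes "X \<subseteq> E"
  shows "cut_edges X (component X a) = {}"
proof (rule equals0I)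
  fix e assume e: "e \<in> cut_edges X (component X a)"
  then obtain p q where "e = {p, q}" "e \<in> X" "p \<in> component X a" "q \<notin> component X a"
    using assms by (rule cut_edgesE)
  then show False using reachable_step unfolding component_def by fast
qed

lemma exists_pair_join:
  assumes "D \<subseteq> E" "reachable D a b"
  shows "\<exists>X\<subseteq>D. odd_vertices X = sym_diff {a} {b}"
  using assms(2)
proof (induction rule: reachable_induct)
  case refl
  then show ?case by (intro exI[of _ "{}"]) auto
next
  case (step b c)
  then obtain X where X: "X \<subseteq> D" "odd_vertices X = sym_diff {a} {b}" by blast
  have "b \<noteq> c" using card_edge[of "{b, c}"] step assms(1) by auto
  have "odd_vertices (sym_diff X {{b, c}}) = sym_diff (sym_diff {a} {b}) {b, c}"
    using odd_vertices_edges_sym_diff[of X "{{b, c}}"] X assms(1) step by auto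
  also have "\<dots> = sym_diff {a} {c}" using \<open>b \<noteq> c\<close> by auto
  finally show ?case using X step by (intro exI[of _ "sym_diff X {{b, c}}"]) auto
qed

lemma exists_join_up_to_root:
  assumes "D \<subseteq> E" "finite A" "A \<subseteq> component D v"
  shows "\<exists>X\<subseteq>D. sym_diff (odd_vertices X) A \<subseteq> {v}"
  using assms(2,3)
proof (induction A rule: finite_induct)
  case empty
  then show ?case by (intro exI[of _ "{}"]) auto
next
  case (insert a A)
  then obtain X where X: "X \<subseteq> D" "sym_diff (odd_vertices X) A \<subseteq> {v}" by auto
  obtain P where P: "P \<subseteq> D" "odd_vertices P = sym_diff {v} {a}"
    using exists_pair_join[OF assms(1), of v a] insert.prems by (auto simp: component_def)
  have "odd_vertices (sym_diff X P) = sym_diff (odd_vertices X) (sym_diff {v} {a})"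
    using odd_vertices_edges_sym_diff[of X P] X P assms(1) by auto
  then have "sym_diff (odd_vertices (sym_diff X P)) (insert a A) \<subseteq> {v}"
    using X(2) insert.hyps(2) by auto
  moreover have "sym_diff X P \<subseteq> D" using X P by auto
  ultimately show ?case by blast
qed

lemma exists_join_of_even_set:
  assumes "D \<subseteq> E" "finite A" "A \<subseteq> component D v" "even (card A)"
  shows "\<exists>X\<subseteq>D. odd_vertices X = A"
proof -
  obtain X where X: "X \<subseteq> D" "sym_diff (odd_vertices X) A \<subseteq> {v}"
    using exists_join_up_to_root[OF assms(1-3)] by blast
  have "X \<subseteq> E" using X assms(1) by blast
  then have "even (card (sym_diff (odd_vertices X) A))"
    using even_card_sym_diff[of "odd_vertices X" A] finite_odd_vertices even_card_odd_vertices
      assms(2,4) by simp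
  then have "sym_diff (odd_vertices X) A \<noteq> {v}"
    by (metis is_singletonI is_singleton_altdef odd_one)
  then have "odd_vertices X = A" using X(2) by blast
  then show ?thesis using X(1) by blast
qed

lemma exists_reachable_entering_edge:
  assumes D: "D \<subseteq> E" "odd_vertices D - K = {u}"
  shows "\<exists>p q. {p, q} \<in> D \<and> p \<notin> K \<and> q \<in> K \<and> reachable {e \<in> D. e \<inter> K = {}} u p"
proof -
  define D' where "D' = {e \<in> D. e \<inter> K = {}}"
  define C where "C = component D' u"
  have D': "D' \<subseteq> E" using D(1) by (auto simp: D'_def)
  have "u \<notin> K" using D(2) by auto
  then have C: "C \<inter> K = {}"
    using component_subset_insert_Union[of D' u] by (auto simp: C_def D'_def)
  then have "C \<inter> odd_vertices D = {u}" using D(2) unfolding C_def by auto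
  then have "cut_edges D C \<noteq> {}"
    using even_card_Int_odd_vertices_iff[OF D(1), of C] by auto
  then obtain e where "e \<in> cut_edges D C" by blast
  then obtain p q where pq: "e = {p, q}" "p \<noteq> q" "e \<in> D" "p \<in> C" "q \<notin> C"
    using D(1) by (rule cut_edgesE)
  have "e \<notin> D'" using cut_edges_component[OF D', of u] cut_edgesI[of p q D' C] pq
    by (auto simp: C_def)
  moreover have "p \<notin> K" using pq(4) C by auto
  ultimately have "q \<in> K" using pq by (auto simp: D'_def)
  then show ?thesis using pq \<open>p \<notin> K\<close> by (auto simp: C_def component_def D'_def)
qed

text \<open>\<open>P\<close> is the part of a walk in \<open>D\<close> from \<open>u\<close> up to its first vertex in \<open>K\<close>.\<close>

lemma exists_walk_entering_once:
  assumes D: "D \<subseteq> E" "odd_vertices D - K = {u}"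
  shows "\<exists>P\<subseteq>D. odd_vertices P - K = {u} \<and> card (cut_edges P K) = 1"
proof -
  define D' where "D' = {e \<in> D. e \<inter> K = {}}"
  have D': "D' \<subseteq> E" using D(1) by (auto simp: D'_def)
  obtain p q where pq: "{p, q} \<in> D" "p \<notin> K" "q \<in> K" "reachable D' u p"
    using exists_reachable_entering_edge[OF D] unfolding D'_def by blast
  obtain X where X: "X \<subseteq> D'" "odd_vertices X = sym_diff {u} {p}"
    using exists_pair_join[OF D' pq(4)] by blast
  have "{p, q} \<notin> X" using X(1) pq(3) by (auto simp: D'_def)
  then have "odd_vertices (insert {p, q} X) = sym_diff (sym_diff {u} {p}) {p, q}"
    using odd_vertices_insert[of X "{p, q}"] finite_edges[of X] D' X by auto
  moreover have "u \<notin> K" using D(2) by auto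
  ultimately have "odd_vertices (insert {p, q} X) - K = {u}" using pq(2,3) by auto
  moreover have "cut_edges (insert {p, q} X) K = {{p, q}}"
  proof -
    have "d \<inter> K = {}" if "d \<in> X" for d using X(1) that by (auto simp: D'_def)
    then have "cut_edges X K = {}" by (auto simp: cut_edges_def)
    moreover have "card ({p, q} \<inter> K) = 1" using pq(2,3) by simp
    ultimately show ?thesis by (simp add: cut_edges_insert)
  qed
  moreover have "insert {p, q} X \<subseteq> D" using X(1) pq(1) by (auto simp: D'_def)
  ultimately show ?thesis by (intro exI[of _ "insert {p, q} X"]) simp
qed

lemma exists_closed_walk_crossing_twice:
  assumes D: "D \<subseteq> E" "odd_vertices D \<subseteq> K" "cut_edges D K \<noteq> {}"
  shows "\<exists>C\<subseteq>D. odd_vertices C \<subseteq> K \<and> card (cut_edges C K) = 2"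
proof -
  obtain e where e: "e \<in> cut_edges D K" using D(3) by blast
  then obtain p q where pq: "e = {p, q}" "p \<noteq> q" "e \<in> D" "p \<in> K" "q \<notin> K"
    using D(1) by (rule cut_edgesE)
  have "odd_vertices (D - {e}) = sym_diff (odd_vertices D) e"
    using odd_vertices_Diff[OF finite_edges[OF D(1)], of "{e}"] pq by simp
  then have "odd_vertices (D - {e}) - K = {q}" using D(2) pq by auto
  then obtain P where P: "P \<subseteq> D - {e}" "odd_vertices P - K = {q}" "card (cut_edges P K) = 1"
    using exists_walk_entering_once[of "D - {e}" K q] D(1) by auto
  have "e \<notin> P" "finite P" using P(1) finite_edges D(1) by blast+
  then have "odd_vertices (insert e P) \<subseteq> K"
    using odd_vertices_insert[of P e] P(2) pq by auto
  moreover have "card (cut_edges (insert e P) K) = 2"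
  proof -
    have "card (e \<inter> K) = 1" using e by (simp add: cut_edges_def)
    moreover have "e \<notin> cut_edges P K" using \<open>e \<notin> P\<close> cut_edges_subset by blast
    ultimately show ?thesis
      using P(3) finite_cut_edges[OF \<open>finite P\<close>] by (simp add: cut_edges_insert)
  qed
  ultimately show ?thesis using P(1) pq by (intro exI[of _ "insert e P"]) auto
qed

lemma card_cut_le_cost:
  fixes c :: "'a set \<Rightarrow> int"
  assumes nonneg: "\<And>C. C \<subseteq> E \<Longrightarrow> odd_vertices C \<subseteq> K \<Longrightarrow> 0 \<le> sum c C"
    and crossing: "\<And>C. C \<subseteq> E \<Longrightarrow> odd_vertices C \<subseteq> K \<Longrightarrow> cut_edges C K \<noteq> {} \<Longrightarrow> 2 \<le> sum c C"
    and "D \<subseteq> E" "odd_vertices D \<subseteq> K"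
  shows "int (card (cut_edges D K)) \<le> sum c D"
  using assms(3,4)
proof (induction "card (cut_edges D K)" arbitrary: D rule: less_induct)
  case less
  show ?case
  proof (cases "cut_edges D K = {}")
    case True
    then show ?thesis using nonneg[OF less.prems] by simp
  next
    case False
    then obtain C where C: "C \<subseteq> D" "odd_vertices C \<subseteq> K" "card (cut_edges C K) = 2"
      using exists_closed_walk_crossing_twice[OF less.prems] by blast
    have fD: "finite D" using finite_edges less.prems(1) .
    have card: "card (cut_edges D K) = card (cut_edges (D - C) K) + 2"
      using card_cut_edges_Diff[OF fD C(1)] C(3) by simp
    have "odd_vertices (D - C) \<subseteq> K"
      using odd_vertices_Diff[OF fD C(1)] C less.prems by auto
    then have "int (card (cut_edges (D - C) K)) \<le> sum c (D - C)"
      using less.hyps[of "D - C"] less.prems card by auto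
    moreover have "cut_edges C K \<noteq> {}" using C(3) by auto
    then have "2 \<le> sum c C" using crossing[of C] C less.prems by auto
    moreover have "sum c D = sum c (D - C) + sum c C"
      using C(1) fD by (simp add: sum.subset_diff)
    ultimately show ?thesis using card by simp
  qed
qed

end

subsection \<open>An odd cut that can be lowered\<close>

locale even_weighted_graph = finite_graph +
  fixes w :: "'a set \<Rightarrow> nat"
  assumes even_cycle: "X \<subseteq> E \<Longrightarrow> odd_vertices X = {} \<Longrightarrow> even (sum w X)"
begin

definition null_edges :: "'a set set"
  where "null_edges = {e \<in> E. w e = 0}"

lemma null_edges_subset: "null_edges \<subseteq> E"
  by (auto simp: null_edges_def)

lemma null_component_subset:
  assumes "v \<in> V"
  shows "component null_edges v \<subseteq> V"
  using assms component_subset_insert_Union[of null_edges v] Union_edges[OF null_edges_subset]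
  by blast

lemma finite_null_component: "v \<in> V \<Longrightarrow> finite (component null_edges v)"
  using finite_subset[OF null_component_subset finite_V] .

lemma weight_pos_on_null_component_cut:
  assumes "e \<in> cut_edges E (component null_edges v)"
  shows "0 < w e"
proof (rule ccontr)
  assume "\<not> 0 < w e"
  then have "e \<in> cut_edges null_edges (component null_edges v)"
    using assms by (auto simp: null_edges_def cut_edges_def)
  then show False using cut_edges_component[OF null_edges_subset] by blast
qed

lemma move_odd_vertices_in_null_component:
  fixes v defines "K \<equiv> component null_edges v"
  assumes "v \<in> V" "X \<subseteq> E" "even (card B)" "sym_diff (odd_vertices X) B \<subseteq> K"
  shows "\<exists>X'\<in>joins E B. sum w X' = sum w X \<and> cut_edges X' K = cut_edges X K"
proof -
  let ?A = "sym_diff (odd_vertices X) B"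
  have A: "finite ?A"
    using finite_subset[OF assms(5)] finite_null_component[OF assms(2)] unfolding K_def by simp
  have "B = sym_diff (odd_vertices X) ?A" by blast
  then have "finite B" using finite_odd_vertices[OF assms(3)] A by (metis finite_Diff finite_Un)
  then have "even (card ?A)"
    using even_card_sym_diff[of "odd_vertices X" B] finite_odd_vertices even_card_odd_vertices
      assms(3,4) by simp
  then obtain Y where Y: "Y \<subseteq> null_edges" "odd_vertices Y = ?A"
    using exists_join_of_even_set[OF null_edges_subset A] assms(5) unfolding K_def by blast
  have YE: "Y \<subseteq> E" using Y(1) null_edges_subset by blast
  have null: "w e = 0" if "e \<in> Y" for e using Y(1) that by (auto simp: null_edges_def)
  have "odd_vertices (sym_diff X Y) = sym_diff (odd_vertices X) ?A"
    using odd_vertices_edges_sym_diff[OF assms(3) YE] Y(2) by simp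
  then have "odd_vertices (sym_diff X Y) = B" by blast
  moreover have "sym_diff X Y \<subseteq> E" using assms(3) YE by blast
  moreover have "sum w (sym_diff X Y) = sum w X"
    using sum_sym_diff_plus_Int[of X Y w] finite_edges assms(3) YE null by simp
  moreover have "cut_edges (sym_diff X Y) K = cut_edges X K"
    using cut_edges_component[OF null_edges_subset, of v] cut_edges_mono[OF Y(1), of K]
    by (simp add: K_def cut_edges_sym_diff)
  ultimately show ?thesis by (intro bexI[of _ "sym_diff X Y"]) (auto intro: joinsI)
qed

end

definition signed_weight :: "('e \<Rightarrow> nat) \<Rightarrow> 'e set \<Rightarrow> 'e \<Rightarrow> int"
  where "signed_weight w F e = (if e \<in> F then - int (w e) else int (w e))"

lemma sum_sym_diff_eq_signed_weight:
  assumes "finite D" "finite F"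
  shows "int (sum w (sym_diff D F)) = int (sum w F) + sum (signed_weight w F) D"
proof -
  have "sum w (sym_diff D F) = sum w (D - F) + sum w (F - D)"
    using assms by (intro sum.union_disjoint) auto
  moreover have "sum w F = sum w (F - D) + sum w (D \<inter> F)"
    using assms by (metis Int_commute sum.Int_Diff add.commute)
  moreover have "sum (signed_weight w F) D = - int (sum w (D \<inter> F)) + int (sum w (D - F))"
    using assms sum.If_cases[of D "\<lambda>e. e \<in> F" "\<lambda>e. - int (w e)" "\<lambda>e. int (w e)"]
    by (simp add: signed_weight_def sum_negf Diff_eq)
  ultimately show ?thesis by simp
qed

text \<open>The argument is due to Sebo: among all pairs \<open>u\<close>, \<open>v\<close>, let \<open>F\<close> be a lightest join of the
  symmetric difference of \<open>T\<close> and \<open>{u, v}\<close>, and let \<open>K\<close> be the component of \<open>v\<close> in the null edges.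
  No such lightest join has an edge leaving \<open>K\<close>, so every closed walk through \<open>K\<close> (with \<open>K\<close>
  contracted) has positive, hence by parity at least 2, cost relative to \<open>F\<close>.\<close>

locale lightest_near_join = even_weighted_graph V E w
  for V :: "'a set" and E and w +
  fixes T :: "'a set" and F :: "'a set set" and u v :: 'a
  assumes u_in_V: "u \<in> V" and v_in_V: "v \<in> V"
    and F_join: "F \<in> joins E (sym_diff T (sym_diff {u} {v}))"
    and F_lightest: "a \<in> V \<Longrightarrow> b \<in> V \<Longrightarrow> X \<in> joins E (sym_diff T (sym_diff {a} {b})) \<Longrightarrow>
      sum w F \<le> sum w X"
    and F_lighter_than_join: "J \<in> joins E T \<Longrightarrow> sum w F < sum w J"
begin

definition K :: "'a set"
  where "K = component null_edges v"

lemma v_in_K: "v \<in> K"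
  by (simp add: K_def)

lemma K_subset: "K \<subseteq> V"
  unfolding K_def by (rule null_component_subset[OF v_in_V])

lemmas move_odd_vertices_in_K =
  move_odd_vertices_in_null_component[OF v_in_V, folded K_def]

lemma F_subset: "F \<subseteq> E"
  using F_join by (rule joins_subset)

lemma odd_vertices_F: "odd_vertices F = sym_diff T (sym_diff {u} {v})"
  using F_join by (rule joins_odd_vertices)

lemma T_eq: "T = sym_diff (odd_vertices F) (sym_diff {u} {v})"
  unfolding odd_vertices_F by blast

lemma finite_T: "finite T"
  using finite_odd_vertices[OF F_subset] T_eq
  by (metis finite.emptyI finite.insertI finite_Diff finite_Un)

lemma even_card_T: "even (card T)"
  using even_card_sym_diff_pair[OF finite_T] even_card_odd_vertices[OF F_subset] odd_vertices_F
  by metis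

lemma u_notin_K: "u \<notin> K"
proof
  assume "u \<in> K"
  have "sym_diff (odd_vertices F) T \<subseteq> {u, v}" unfolding odd_vertices_F by blast
  then have "sym_diff (odd_vertices F) T \<subseteq> K" using \<open>u \<in> K\<close> v_in_K by blast
  then obtain J where "J \<in> joins E T" "sum w J = sum w F"
    using move_odd_vertices_in_K[OF F_subset even_card_T] by blast
  then show False using F_lighter_than_join[of J] by simp
qed

lemma lightest_avoids_cut:
  assumes G: "G \<in> joins E (odd_vertices F)" "sum w G \<le> sum w F"
  shows "cut_edges G K = {}"
proof (rule equals0I)
  fix e assume e: "e \<in> cut_edges G K"
  have GE: "G \<subseteq> E" and odd_G: "odd_vertices G = odd_vertices F"
    using joinsD[OF G(1)] by simp_all
  from e GE obtain p q where pq: "e = {p, q}" "p \<noteq> q" "e \<in> G" "p \<in> K" "q \<notin> K"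
    by (rule cut_edgesE)
  have "odd_vertices (G - {e}) = sym_diff (odd_vertices F) {p, q}"
    using odd_vertices_Diff[OF finite_edges[OF GE], of "{e}"] pq odd_G by simp
  then have "sym_diff (odd_vertices (G - {e})) (sym_diff T (sym_diff {u} {q})) \<subseteq> {v, p}"
    unfolding odd_vertices_F using \<open>p \<noteq> q\<close> by blast
  then have "sym_diff (odd_vertices (G - {e})) (sym_diff T (sym_diff {u} {q})) \<subseteq> K"
    using pq v_in_K by blast
  moreover have "even (card (sym_diff T (sym_diff {u} {q})))"
    using even_card_sym_diff_pair[OF finite_T] even_card_T by blast
  ultimately obtain X where "X \<in> joins E (sym_diff T (sym_diff {u} {q}))"
      "sum w X = sum w (G - {e})"
    using move_odd_vertices_in_K[of "G - {e}"] GE by blast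
  moreover have "q \<in> V" using Union_edges[OF GE] pq by blast
  ultimately have "sum w F \<le> sum w (G - {e})" using F_lightest u_in_V by metis
  also have "\<dots> < sum w G"
  proof -
    have "0 < w e"
      using weight_pos_on_null_component_cut e cut_edges_mono[OF GE] unfolding K_def by blast
    then show ?thesis using pq finite_edges[OF GE] by (simp add: sum.remove)
  qed
  finally show False using G(2) by simp
qed

lemma F_avoids_cut: "cut_edges F K = {}"
  using lightest_avoids_cut[of F] F_subset by (simp add: joinsI)

lemma odd_card_K_Int_T: "odd (card (K \<inter> T))"
proof -
  have "K \<inter> odd_vertices F = sym_diff (K \<inter> T) {v}"
    unfolding odd_vertices_F using u_notin_K v_in_K by blast
  then have "even (card (sym_diff (K \<inter> T) {v}))"
    using even_card_Int_odd_vertices_iff[OF F_subset, of K] F_avoids_cut by simp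
  then show ?thesis using even_card_sym_diff[of "K \<inter> T" "{v}"] finite_T by simp
qed

lemma exists_join_of_signed_weight:
  assumes C: "C \<subseteq> E"
    and B: "even (card B)" "sym_diff (sym_diff (odd_vertices C) (odd_vertices F)) B \<subseteq> K"
  shows "\<exists>G\<in>joins E B. int (sum w G) = int (sum w F) + sum (signed_weight w F) C \<and>
    cut_edges G K = cut_edges C K"
proof -
  have "odd_vertices (sym_diff C F) = sym_diff (odd_vertices C) (odd_vertices F)"
    using odd_vertices_edges_sym_diff[OF C F_subset] .
  then obtain G where "G \<in> joins E B" "sum w G = sum w (sym_diff C F)"
      "cut_edges G K = cut_edges (sym_diff C F) K"
    using move_odd_vertices_in_K[of "sym_diff C F" B] C F_subset B by auto
  moreover have "int (sum w (sym_diff C F)) = int (sum w F) + sum (signed_weight w F) C"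
    using sum_sym_diff_eq_signed_weight finite_edges C F_subset by blast
  moreover have "cut_edges (sym_diff C F) K = cut_edges C K"
    by (simp add: cut_edges_sym_diff F_avoids_cut)
  ultimately show ?thesis by metis
qed

lemma signed_weight_closed:
  assumes C: "C \<subseteq> E" "odd_vertices C \<subseteq> K"
  shows signed_weight_closed_nonneg: "0 \<le> sum (signed_weight w F) C"
    and signed_weight_crossing_ge_2: "cut_edges C K \<noteq> {} \<Longrightarrow> 2 \<le> sum (signed_weight w F) C"
proof -
  have "sym_diff (sym_diff (odd_vertices C) (odd_vertices F)) (odd_vertices F) \<subseteq> K"
    using C(2) by blast
  then obtain G where G: "G \<in> joins E (odd_vertices F)"
      "int (sum w G) = int (sum w F) + sum (signed_weight w F) C" "cut_edges G K = cut_edges C K"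
    using exists_join_of_signed_weight[OF C(1) even_card_odd_vertices[OF F_subset]] by blast
  have "sum w F \<le> sum w G"
    using F_lightest[OF u_in_V v_in_V] G(1) odd_vertices_F by simp
  then show nonneg: "0 \<le> sum (signed_weight w F) C" using G(2) by linarith
  assume "cut_edges C K \<noteq> {}"
  then have "sum w F < sum w G" using lightest_avoids_cut[OF G(1)] G(3) by auto
  then have "0 < sum (signed_weight w F) C" using G(2) by linarith
  moreover have "even (sum (signed_weight w F) C)"
  proof -
    have GE: "G \<subseteq> E" and "odd_vertices G = odd_vertices F" using joinsD[OF G(1)] by simp_all
    then have "even (sum w (sym_diff G F))"
      using even_cycle[of "sym_diff G F"] odd_vertices_edges_sym_diff[OF GE F_subset] F_subset
      by auto
    then have "even (sum w G + sum w F)"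
      using even_sum_sym_diff[of G F w] finite_edges GE F_subset by simp
    then have "even (int (sum w G) + int (sum w F))" by presburger
    then show ?thesis unfolding G(2) by simp
  qed
  ultimately show "2 \<le> sum (signed_weight w F) C" by presburger
qed

lemma exists_walk_splitting_join:
  assumes J: "J \<in> joins E T"
  shows "\<exists>P\<subseteq>sym_diff J F. odd_vertices P - K = {u} \<and> card (cut_edges P K) = 1 \<and>
    odd_vertices (sym_diff J F - P) \<subseteq> K"
proof -
  have JE: "J \<subseteq> E" using J by (rule joins_subset)
  have DE: "sym_diff J F \<subseteq> E" using JE F_subset by auto
  have "odd_vertices (sym_diff J F) = sym_diff T (sym_diff T (sym_diff {u} {v}))"
    unfolding odd_vertices_edges_sym_diff[OF JE F_subset] joins_odd_vertices[OF J]
      odd_vertices_F ..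
  then have "odd_vertices (sym_diff J F) = sym_diff {u} {v}" by blast
  then have odd: "odd_vertices (sym_diff J F) - K = {u}" using u_notin_K v_in_K by auto
  then obtain P where P: "P \<subseteq> sym_diff J F" "odd_vertices P - K = {u}" "card (cut_edges P K) = 1"
    using exists_walk_entering_once[OF DE odd] by blast
  have "odd_vertices (sym_diff J F - P) \<subseteq> K"
    unfolding odd_vertices_Diff[OF finite_edges[OF DE] P(1)] using odd P(2) by blast
  then show ?thesis using P by blast
qed

text \<open>The symmetric difference of \<open>J\<close> and \<open>F\<close> splits into a walk \<open>P\<close> from \<open>u\<close> to \<open>K\<close>, which leads to
  \<open>J'\<close>, and closed walks modulo \<open>K\<close>, which account for the remaining edges of \<open>J\<close> in the cut.\<close>

lemma exists_join_exceeded_by_cut: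
  assumes J: "J \<in> joins E T"
  shows "\<exists>J'\<in>joins E T. sum w J' + card (cut_edges J K) \<le> sum w J + 1"
proof -
  define D where "D = sym_diff J F"
  have DE: "D \<subseteq> E" using joins_subset[OF J] F_subset by (auto simp: D_def)
  have fD: "finite D" using finite_edges[OF DE] .
  obtain P where P: "P \<subseteq> D" "odd_vertices P - K = {u}" "card (cut_edges P K) = 1"
      "odd_vertices (D - P) \<subseteq> K"
    using exists_walk_splitting_join[OF J] unfolding D_def by blast
  have "sym_diff (sym_diff (odd_vertices P) (odd_vertices F)) T \<subseteq> K"
    unfolding odd_vertices_F using P(2) v_in_K u_notin_K by blast
  then obtain J' where J': "J' \<in> joins E T"
      "int (sum w J') = int (sum w F) + sum (signed_weight w F) P"
    using exists_join_of_signed_weight[OF subset_trans[OF P(1) DE] even_card_T] by blast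
  have "int (card (cut_edges (D - P) K)) \<le> sum (signed_weight w F) (D - P)"
    using DE P(4) by (intro card_cut_le_cost signed_weight_closed) auto
  moreover have "sum (signed_weight w F) D =
      sum (signed_weight w F) (D - P) + sum (signed_weight w F) P"
    using P(1) fD by (simp add: sum.subset_diff)
  moreover have "card (cut_edges J K) = card (cut_edges (D - P) K) + 1"
  proof -
    have "cut_edges J K = cut_edges D K"
      by (simp add: D_def cut_edges_sym_diff F_avoids_cut)
    then show ?thesis using card_cut_edges_Diff[OF fD P(1)] P(3) by simp
  qed
  moreover have "int (sum w J) = int (sum w F) + sum (signed_weight w F) D"
  proof -
    have "sym_diff D F = J" by (auto simp: D_def)
    then show ?thesis
      using sum_sym_diff_eq_signed_weight[OF fD finite_edges[OF F_subset], of w] by simp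
  qed
  ultimately have "sum w J' + card (cut_edges J K) \<le> sum w J + 1" using J'(2) by linarith
  then show ?thesis using J'(1) by blast
qed

end

context even_weighted_graph
begin

definition near_join :: "'a set \<Rightarrow> 'a set set \<Rightarrow> bool"
  where "near_join T X \<longleftrightarrow>
    (\<exists>a\<in>V. \<exists>b\<in>V. X \<in> joins E (sym_diff T (sym_diff {a} {b})))"

lemma exists_lighter_near_join:
  assumes J: "J \<in> joins E T" and pos: "0 < sum w J"
  shows "\<exists>X. near_join T X \<and> sum w X < sum w J"
proof -
  have JE: "J \<subseteq> E" using J by (rule joins_subset)
  have "\<exists>e\<in>J. w e \<noteq> 0" using pos by (metis less_irrefl sum.neutral)
  then obtain e where e: "e \<in> J" "0 < w e" by blast
  then have "card e = 2" "e \<subseteq> V" using card_edge Union_edges[OF JE] JE by blast+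
  then obtain a b where ab: "e = sym_diff {a} {b}" "a \<in> V" "b \<in> V"
    by (auto simp: card_2_iff)
  have "odd_vertices (J - {e}) = sym_diff T (sym_diff {a} {b})"
    using odd_vertices_Diff[OF finite_edges[OF JE], of "{e}"] joins_odd_vertices[OF J] e(1)
    by (simp flip: ab(1))
  then have "near_join T (J - {e})"
    using ab(2,3) JE unfolding near_join_def by (blast intro: joinsI)
  moreover have "sum w (J - {e}) < sum w J"
    using e finite_edges[OF JE] by (simp add: sum.remove)
  ultimately show ?thesis by blast
qed

lemma exists_lightest_near_join:
  assumes J: "J \<in> joins E T" and pos: "\<And>J. J \<in> joins E T \<Longrightarrow> 0 < sum w J"
  shows "\<exists>F u v. lightest_near_join V E w T F u v"
proof -
  obtain X where "near_join T X" using exists_lighter_near_join[OF J pos[OF J]] by blast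
  then obtain F where F: "near_join T F" "\<And>X. near_join T X \<Longrightarrow> sum w F \<le> sum w X"
    using ex_has_least_nat[of "near_join T" X "sum w"] by blast
  obtain u v where uv: "u \<in> V" "v \<in> V" "F \<in> joins E (sym_diff T (sym_diff {u} {v}))"
    using F(1) unfolding near_join_def by blast
  have "lightest_near_join V E w T F u v"
  proof unfold_locales
    show "sum w F \<le> sum w X"
      if "a \<in> V" "b \<in> V" "X \<in> joins E (sym_diff T (sym_diff {a} {b}))" for a b X
      using F(2) that unfolding near_join_def by blast
    show "sum w F < sum w J" if "J \<in> joins E T" for J
      using exists_lighter_near_join[OF that pos[OF that]] F(2) le_less_trans by blast
  qed (fact uv)+
  then show ?thesis by blast
qed

lemma exists_odd_cut_to_lower:
  assumes "J \<in> joins E T" "\<And>J. J \<in> joins E T \<Longrightarrow> 0 < sum w J"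
  shows "\<exists>K\<subseteq>V. odd (card (K \<inter> T)) \<and> (\<forall>e\<in>cut_edges E K. 0 < w e) \<and>
    (\<forall>J\<in>joins E T. \<exists>J'\<in>joins E T. sum w J' + card (cut_edges J K) \<le> sum w J + 1)"
proof -
  obtain F u v where "lightest_near_join V E w T F u v"
    using exists_lightest_near_join[OF assms] by blast
  then interpret lightest_near_join V E w T F u v .
  have "\<forall>e\<in>cut_edges E K. 0 < w e"
    unfolding K_def using weight_pos_on_null_component_cut by blast
  then show ?thesis using K_subset odd_card_K_Int_T exists_join_exceeded_by_cut by blast
qed

end

subsection \<open>Minimum weight joins\<close>

definition lower_on :: "'e set \<Rightarrow> ('e \<Rightarrow> nat) \<Rightarrow> 'e \<Rightarrow> nat"
  where "lower_on C w e = w e - of_bool (e \<in> C)"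

lemma (in finite_graph) sum_mult_lower_on_cut:
  fixes y :: "'a set \<Rightarrow> 'b::comm_semiring_1"
  assumes X: "X \<subseteq> E" and w: "\<And>e. e \<in> cut_edges E K \<Longrightarrow> 0 < w e"
  shows "(\<Sum>e\<in>X. of_nat (w e) * y e) =
    (\<Sum>e\<in>X. of_nat (lower_on (cut_edges E K) w e) * y e) + sum y (cut_edges X K)"
proof -
  have "of_nat (w e) * y e =
      of_nat (lower_on (cut_edges E K) w e) * y e + (if e \<in> cut_edges E K then y e else 0)" for e
    using w[of e] by (cases "w e") (auto simp: lower_on_def algebra_simps)
  then show ?thesis
    using finite_edges[OF X]
    by (simp add: sum.distrib cut_edges_Int_right[OF X] flip: sum.inter_restrict)
qed

definition (in finite_graph) fractional_cut_cover :: "'a set \<Rightarrow> ('a set \<Rightarrow> real) \<Rightarrow> bool"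
  where "fractional_cut_cover T y \<longleftrightarrow> (\<forall>e\<in>E. 0 \<le> y e) \<and>
    (\<forall>S\<subseteq>V. odd (card (S \<inter> T)) \<longrightarrow> 1 \<le> sum y (cut_edges E S))"

context even_weighted_graph
begin

lemma even_weighted_graph_lower_on_cut:
  assumes "\<And>e. e \<in> cut_edges E K \<Longrightarrow> 0 < w e"
  shows "even_weighted_graph V E (lower_on (cut_edges E K) w)"
proof unfold_locales
  fix X assume X: "X \<subseteq> E" "odd_vertices X = {}"
  have "sum w X = sum (lower_on (cut_edges E K) w) X + card (cut_edges X K)"
    using sum_mult_lower_on_cut[OF X(1) assms, where y = "\<lambda>_. 1 :: nat"] by simp
  moreover have "even (card (cut_edges X K))"
    using even_card_Int_odd_vertices_iff[OF X(1), of K] X(2) by simp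
  ultimately show "even (sum (lower_on (cut_edges E K) w) X)" using even_cycle[OF X] by simp
qed

lemma exists_lower_weight_reduction:
  assumes "joins E T \<noteq> {}" and pos: "\<And>J. J \<in> joins E T \<Longrightarrow> 0 < sum w J"
    and y: "fractional_cut_cover T y"
  shows "\<exists>w'. even_weighted_graph V E w' \<and> sum w' E < sum w E \<and>
    (\<forall>J\<in>joins E T. real (sum w' J) \<le> (\<Sum>e\<in>E. real (w' e) * y e) \<longrightarrow>
      (\<exists>J'\<in>joins E T. real (sum w J') \<le> (\<Sum>e\<in>E. real (w e) * y e)))"
proof -
  obtain J0 where "J0 \<in> joins E T" using assms(1) by blast
  then obtain K where K: "K \<subseteq> V" "odd (card (K \<inter> T))" "\<And>e. e \<in> cut_edges E K \<Longrightarrow> 0 < w e"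
    and shorten: "\<And>J. J \<in> joins E T \<Longrightarrow>
      \<exists>J'\<in>joins E T. sum w J' + card (cut_edges J K) \<le> sum w J + 1"
    using exists_odd_cut_to_lower[OF _ pos] by metis
  define w' where "w' = lower_on (cut_edges E K) w"
  have weight: "(\<Sum>e\<in>X. real (w e) * z e) = (\<Sum>e\<in>X. real (w' e) * z e) + sum z (cut_edges X K)"
    if "X \<subseteq> E" for X z
    unfolding w'_def using that K(3) by (rule sum_mult_lower_on_cut)
  have sum_weight: "real (sum w X) = real (sum w' X) + real (card (cut_edges X K))"
    if "X \<subseteq> E" for X
    using weight[OF that, of "\<lambda>_. 1"] by simp
  have y_K: "1 \<le> sum y (cut_edges E K)" using y K(1,2) by (simp add: fractional_cut_cover_def)
  then have "cut_edges E K \<noteq> {}" by auto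
  then have "0 < card (cut_edges E K)"
    using finite_cut_edges[OF finite_E] by (simp add: card_gt_0_iff)
  then have "sum w' E < sum w E" using sum_weight[OF order_refl] by linarith
  moreover have "even_weighted_graph V E w'"
    unfolding w'_def using K(3) by (rule even_weighted_graph_lower_on_cut)
  moreover have "\<exists>J'\<in>joins E T. real (sum w J') \<le> (\<Sum>e\<in>E. real (w e) * y e)"
    if J: "J \<in> joins E T" "real (sum w' J) \<le> (\<Sum>e\<in>E. real (w' e) * y e)" for J
  proof -
    obtain J' where J': "J' \<in> joins E T" "sum w J' + card (cut_edges J K) \<le> sum w J + 1"
      using shorten[OF J(1)] by blast
    have "real (sum w J') \<le> real (sum w' J) + 1"
      using J'(2) sum_weight[OF joins_subset[OF J(1)]] by linarith
    also have "\<dots> \<le> (\<Sum>e\<in>E. real (w e) * y e)"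
      using J(2) y_K weight[OF order_refl, of y] by linarith
    finally show ?thesis using J'(1) by blast
  qed
  ultimately show ?thesis by blast
qed

end

context finite_graph
begin

lemma exists_join_weight_le_nat:
  assumes "joins E T \<noteq> {}" and y: "fractional_cut_cover T y" and "even_weighted_graph V E w"
  shows "\<exists>J\<in>joins E T. real (sum w J) \<le> (\<Sum>e\<in>E. real (w e) * y e)"
  using assms(3)
proof (induction "sum w E" arbitrary: w rule: less_induct)
  case less
  interpret even_weighted_graph V E w by fact
  show ?case
  proof (cases "\<exists>J\<in>joins E T. sum w J = 0")
    case True
    have "0 \<le> (\<Sum>e\<in>E. real (w e) * y e)"
      using y by (intro sum_nonneg) (simp add: fractional_cut_cover_def)
    then show ?thesis using True by (metis of_nat_0)
  next
    case False
    then have pos: "0 < sum w J" if "J \<in> joins E T" for J using that by (metis gr0I)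
    obtain w' where w': "even_weighted_graph V E w'" "sum w' E < sum w E"
      and lift: "\<And>J. J \<in> joins E T \<Longrightarrow> real (sum w' J) \<le> (\<Sum>e\<in>E. real (w' e) * y e) \<Longrightarrow>
        \<exists>J'\<in>joins E T. real (sum w J') \<le> (\<Sum>e\<in>E. real (w e) * y e)"
      using exists_lower_weight_reduction[OF assms(1) pos y] by blast
    obtain J where "J \<in> joins E T" "real (sum w' J) \<le> (\<Sum>e\<in>E. real (w' e) * y e)"
      using less.hyps[OF w'(2,1)] by blast
    then show ?thesis by (rule lift)
  qed
qed

lemma exists_join_weight_le_approx:
  fixes w :: "'a set \<Rightarrow> real" and N :: nat
  assumes "joins E T \<noteq> {}" and y: "fractional_cut_cover T y"
    and w: "\<And>e. e \<in> E \<Longrightarrow> 0 \<le> w e" and N: "0 < N"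
  shows "\<exists>J\<in>joins E T. sum w J \<le> (\<Sum>e\<in>E. w e * y e) + sum y E / N"
proof -
  define c where "c e = nat \<lceil>N * w e\<rceil>" for e
  have c: "N * w e \<le> c e" "c e \<le> N * w e + 1" if "e \<in> E" for e
  proof -
    have "0 \<le> N * w e" using w[OF that] by simp
    then have "real (c e) = of_int \<lceil>N * w e\<rceil>" by (simp add: c_def)
    then show "N * w e \<le> c e" "c e \<le> N * w e + 1" by linarith+
  qed
  have "even_weighted_graph V E (\<lambda>e. 2 * c e)"
    by unfold_locales (simp flip: sum_distrib_left)
  then obtain J where J: "J \<in> joins E T"
      "real (\<Sum>e\<in>J. 2 * c e) \<le> (\<Sum>e\<in>E. real (2 * c e) * y e)"
    using exists_join_weight_le_nat[OF assms(1) y] by blast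
  have "N * sum w J \<le> (\<Sum>e\<in>J. real (c e))"
    unfolding sum_distrib_left using c joins_subset[OF J(1)] by (intro sum_mono) auto
  also have "\<dots> \<le> (\<Sum>e\<in>E. c e * y e)"
    using J(2) by (simp add: mult.assoc flip: sum_distrib_left)
  also have "\<dots> \<le> (\<Sum>e\<in>E. (N * w e + 1) * y e)"
    using c y by (intro sum_mono mult_right_mono) (auto simp: fractional_cut_cover_def)
  also have "\<dots> = N * (\<Sum>e\<in>E. w e * y e) + sum y E"
    by (simp add: algebra_simps sum.distrib sum_distrib_left)
  finally show ?thesis using N J(1) by (intro bexI[of _ J]) (simp_all add: field_simps)
qed

lemma exists_join_weight_le:
  fixes w :: "'a set \<Rightarrow> real"
  assumes "joins E T \<noteq> {}" "fractional_cut_cover T y" "\<And>e. e \<in> E \<Longrightarrow> 0 \<le> w e"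
  shows "\<exists>J\<in>joins E T. sum w J \<le> (\<Sum>e\<in>E. w e * y e)"
proof -
  define J where "J = arg_min_on (sum w) (joins E T)"
  have J: "J \<in> joins E T"
    unfolding J_def by (rule arg_min_if_finite(1)[OF finite_joins assms(1)])
  have "sum w J \<le> sum w J'" if "J' \<in> joins E T" for J'
    unfolding J_def by (rule arg_min_least[OF finite_joins assms(1) that])
  then have approx: "sum w J \<le> (\<Sum>e\<in>E. w e * y e) + sum y E / real N" if "N > 0" for N :: nat
    using exists_join_weight_le_approx[OF assms that] by (meson order_trans)
  have "sum w J \<le> (\<Sum>e\<in>E. w e * y e)"
  proof (rule LIMSEQ_le_const)
    show "(\<lambda>N. (\<Sum>e\<in>E. w e * y e) + sum y E / real N) \<longlonglongrightarrow> (\<Sum>e\<in>E. w e * y e)"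
      using tendsto_add[OF tendsto_const lim_const_over_n] by simp
    show "\<exists>N. \<forall>n\<ge>N. sum w J \<le> (\<Sum>e\<in>E. w e * y e) + sum y E / real n"
      using approx by (intro exI[of _ 1]) auto
  qed
  then show ?thesis using J by blast
qed

end

subsection \<open>Convex hulls of sets of functions\<close>

lemma compact_convex_hull_finite_functions:
  fixes A :: "('e \<Rightarrow> real) set"
  assumes "finite A"
  shows "compact (convex hull A)"
  using assms
proof (induction A rule: finite_induct)
  case empty
  then show ?case by simp
next
  case (insert a A)
  show ?case
  proof (cases "A = {}")
    case True
    then show ?thesis by simp
  next
    case False
    let ?segment = "\<lambda>(u, b). (1 - u) *\<^sub>R a + u *\<^sub>R b"
    have image: "convex hull (insert a A) = ?segment ` ({0..1} \<times> (convex hull A))"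
      by (simp add: convex_hull_insert_alt False) force
    have "continuous_on ({0..1} \<times> (convex hull A)) (\<lambda>p. (1 - fst p) * a e + fst p * snd p e)"
      for e
      by (intro continuous_intros
          continuous_on_product_then_coordinatewise[OF continuous_on_snd[OF continuous_on_id]])
    then have continuous: "continuous_on ({0..1} \<times> (convex hull A)) ?segment"
      by (intro continuous_on_coordinatewise_then_product) (simp add: case_prod_unfold)
    show ?thesis
      unfolding image
      by (rule compact_continuous_image[OF continuous compact_Times[OF compact_Icc insert.IH]])
  qed
qed

lemma convex_hull_translate_mem:
  assumes "t \<in> convex hull S" "convex T" "\<And>s. s \<in> S \<Longrightarrow> c + s \<in> T"
  shows "c + t \<in> T"
proof -
  have "c + t \<in> (+) c ` (convex hull S)" using assms(1) by blast
  also have "\<dots> = convex hull ((+) c ` S)" by (simp add: convex_hull_translation)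
  also have "\<dots> \<subseteq> T" using assms(2,3) by (intro hull_minimal) auto
  finally show ?thesis .
qed

lemma convex_hull_mem_vanishing:
  fixes x :: "'e \<Rightarrow> real"
  assumes "x \<in> convex hull S" and S_nonneg: "\<And>s e. s \<in> S \<Longrightarrow> 0 \<le> s e"
    and x_zero: "\<And>e. e \<in> A \<Longrightarrow> x e = 0"
  shows "x \<in> convex hull {s \<in> S. \<forall>e\<in>A. s e = 0}" (is "_ \<in> convex hull ?S0")
proof -
  let ?P = "\<lambda>a. (\<forall>e. 0 \<le> a e) \<and> ((\<forall>e\<in>A. a e = 0) \<longrightarrow> a \<in> convex hull ?S0)"
  from assms(1) have "?P x"
  proof (rule hull_induct)
    show "?P s" if "s \<in> S" for s
      using that S_nonneg by (auto intro: hull_inc)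
    show "convex (Collect ?P)"
    proof (rule convexI)
      fix a b :: "'e \<Rightarrow> real" and u v :: real
      assume "a \<in> Collect ?P" "b \<in> Collect ?P" and uv: "0 \<le> u" "0 \<le> v" "u + v = 1"
      then have a: "?P a" and b: "?P b" by simp_all
      have "u *\<^sub>R a + v *\<^sub>R b \<in> convex hull ?S0" if zero: "\<forall>e\<in>A. (u *\<^sub>R a + v *\<^sub>R b) e = 0"
      proof -
        have "u * a e = 0 \<and> v * b e = 0" if "e \<in> A" for e
          using zero that a b uv by (simp add: add_nonneg_eq_0_iff)
        then consider "u = 0" | "v = 0" | "\<forall>e\<in>A. a e = 0 \<and> b e = 0" by auto
        then show ?thesis
        proof cases
          case 1
          then show ?thesis using uv b zero by simp
        next
          case 2
          then show ?thesis using uv a zero by simp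
        next
          case 3
          then show ?thesis using uv a b by (intro convexD) auto
        qed
      qed
      then show "u *\<^sub>R a + v *\<^sub>R b \<in> Collect ?P" using a b uv by simp
    qed
  qed
  then show ?thesis using x_zero by blast
qed

definition excess :: "('e \<Rightarrow> real) \<Rightarrow> ('e \<Rightarrow> real) \<Rightarrow> 'e \<Rightarrow> real"
  where "excess y z e = max 0 (z e - y e)"

lemma excess_nonneg: "0 \<le> excess y z e"
  by (simp add: excess_def)

lemma excess_times_diff: "excess y z e * (z e - y e) = (excess y z e)\<^sup>2"
  by (simp add: excess_def max_def power2_eq_square)

lemma excess_square_le:
  assumes "z' e = z e + h"
  shows "(excess y z' e)\<^sup>2 \<le> (excess y z e + h)\<^sup>2"
proof (cases "y e \<le> z' e")
  case True
  then show ?thesis using assms by (intro power_mono) (auto simp: excess_def)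
next
  case False
  then show ?thesis by (simp add: excess_def)
qed

text \<open>At a minimiser, the directional derivative of \<open>\<Sum>\<^sub>e (excess y z e)\<^sup>2\<close> towards \<open>c\<close> is
  nonnegative.\<close>

lemma excess_minimizer_variational:
  assumes "convex C" "z \<in> C" "c \<in> C"
    and z_min: "\<And>k. k \<in> C \<Longrightarrow> (\<Sum>e\<in>E. (excess y z e)\<^sup>2) \<le> (\<Sum>e\<in>E. (excess y k e)\<^sup>2)"
  shows "0 \<le> (\<Sum>e\<in>E. excess y z e * (c e - z e))"
proof -
  let ?p = "excess y z" and ?d = "\<lambda>e. c e - z e"
  have step: "0 \<le> 2 * (\<Sum>e\<in>E. ?p e * ?d e) + t * (\<Sum>e\<in>E. (?d e)\<^sup>2)" if t: "0 < t" "t \<le> 1" for t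
  proof -
    let ?k = "(1 - t) *\<^sub>R z + t *\<^sub>R c"
    have "?k \<in> C" using assms(1-3) t by (intro convexD) auto
    then have "(\<Sum>e\<in>E. (?p e)\<^sup>2) \<le> (\<Sum>e\<in>E. (excess y ?k e)\<^sup>2)" by (rule z_min)
    also have "\<dots> \<le> (\<Sum>e\<in>E. (?p e + t * ?d e)\<^sup>2)"
      by (intro sum_mono excess_square_le) (simp add: algebra_simps)
    also have "\<dots> = (\<Sum>e\<in>E. (?p e)\<^sup>2) + t * (2 * (\<Sum>e\<in>E. ?p e * ?d e) + t * (\<Sum>e\<in>E. (?d e)\<^sup>2))"
      unfolding power2_sum power_mult_distrib
      by (simp add: sum.distrib sum_distrib_left power2_eq_square distrib_left mult_ac)
    finally show ?thesis using t(1) by (simp add: zero_le_mult_iff)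
  qed
  have "0 \<le> 2 * (\<Sum>e\<in>E. ?p e * ?d e)"
  proof (rule LIMSEQ_le_const)
    show "(\<lambda>n. 2 * (\<Sum>e\<in>E. ?p e * ?d e) + 1 / real n * (\<Sum>e\<in>E. (?d e)\<^sup>2))
        \<longlonglongrightarrow> 2 * (\<Sum>e\<in>E. ?p e * ?d e)"
      using tendsto_add[OF tendsto_const tendsto_mult_left_zero[OF lim_1_over_n]] by simp
    show "\<exists>N. \<forall>n\<ge>N. 0 \<le> 2 * (\<Sum>e\<in>E. ?p e * ?d e) + 1 / real n * (\<Sum>e\<in>E. (?d e)\<^sup>2)"
      by (intro exI[of _ 1] allI impI step) auto
  qed
  then show ?thesis by simp
qed

lemma exists_dominated_point:
  fixes C :: "('e \<Rightarrow> real) set"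
  assumes "compact C" "convex C" "finite E"
    and weights: "\<And>w. (\<And>e. e \<in> E \<Longrightarrow> 0 \<le> w e) \<Longrightarrow> \<exists>c\<in>C. (\<Sum>e\<in>E. w e * c e) \<le> (\<Sum>e\<in>E. w e * y e)"
  shows "\<exists>z\<in>C. \<forall>e\<in>E. z e \<le> y e"
proof -
  have "C \<noteq> {}" using weights[of "\<lambda>_. 0"] by auto
  moreover have "continuous_on C (\<lambda>z. \<Sum>e\<in>E. (excess y z e)\<^sup>2)"
    unfolding excess_def
    by (intro continuous_intros continuous_on_product_then_coordinatewise[OF continuous_on_id])
  ultimately have "\<exists>z\<in>C. \<forall>k\<in>C. (\<Sum>e\<in>E. (excess y z e)\<^sup>2) \<le> (\<Sum>e\<in>E. (excess y k e)\<^sup>2)"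
    by (rule continuous_attains_inf[OF assms(1)])
  then obtain z where z: "z \<in> C"
      "\<And>k. k \<in> C \<Longrightarrow> (\<Sum>e\<in>E. (excess y z e)\<^sup>2) \<le> (\<Sum>e\<in>E. (excess y k e)\<^sup>2)"
    by blast
  let ?p = "excess y z"
  obtain c where c: "c \<in> C" "(\<Sum>e\<in>E. ?p e * c e) \<le> (\<Sum>e\<in>E. ?p e * y e)"
    using weights[of ?p, OF excess_nonneg] by blast
  have "(\<Sum>e\<in>E. (?p e)\<^sup>2) = (\<Sum>e\<in>E. ?p e * (z e - y e))"
    by (simp only: excess_times_diff)
  also have "\<dots> = (\<Sum>e\<in>E. ?p e * c e) - (\<Sum>e\<in>E. ?p e * y e) - (\<Sum>e\<in>E. ?p e * (c e - z e))"
    by (simp add: sum_subtractf[symmetric] algebra_simps)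
  also have "\<dots> \<le> 0"
    using c(2) excess_minimizer_variational[OF assms(2) z(1) c(1) z(2)] by linarith
  finally have "(\<Sum>e\<in>E. (?p e)\<^sup>2) = 0" by (intro antisym sum_nonneg) auto
  then have "?p e = 0" if "e \<in> E" for e using that assms(3) by (simp add: sum_nonneg_eq_0_iff)
  then have "\<forall>e\<in>E. z e \<le> y e" by (force simp: excess_def max_def split: if_splits)
  then show ?thesis using z(1) by blast
qed

theorem (in finite_graph) edmonds_johnson:
  assumes "joins E T \<noteq> {}" "fractional_cut_cover T y"
  shows "\<exists>z\<in>convex hull (indicator ` joins E T). \<forall>e\<in>E. z e \<le> y e"
proof (rule exists_dominated_point)
  show "compact (convex hull (indicator ` joins E T :: ('a set \<Rightarrow> real) set))"
    using finite_joins by (intro compact_convex_hull_finite_functions) simp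
  show "\<exists>z\<in>convex hull (indicator ` joins E T). (\<Sum>e\<in>E. w e * z e) \<le> (\<Sum>e\<in>E. w e * y e)"
    if w: "\<And>e. e \<in> E \<Longrightarrow> 0 \<le> w e" for w
  proof -
    obtain J where J: "J \<in> joins E T" "sum w J \<le> (\<Sum>e\<in>E. w e * y e)"
      using exists_join_weight_le[OF assms, of w] w by blast
    have "(\<Sum>e\<in>E. w e * indicator J e) = sum w J"
      using finite_E joins_subset[OF J(1)]
      by (simp add: indicator_def if_distrib sum.If_cases Int_absorb1 cong: if_cong)
    then show ?thesis using J by (intro bexI[of _ "indicator J"]) (auto intro: hull_inc)
  qed
qed (simp_all add: finite_E)

subsection \<open>Tours\<close>

interpretation complete_graph: finite_graph "V\<^sub>K n" "E\<^sub>K n" for n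
  by unfold_locales (simp_all add: V\<^sub>K_def E\<^sub>K_def)

lemma convex_T_polyhedron: "convex (T_polyhedron n)"
  by (simp add: T_polyhedron_def)

lemma multi_incidence_in_T_polyhedron: "tour n J \<Longrightarrow> multi_incidence J \<in> T_polyhedron n"
  unfolding T_polyhedron_def by (rule hull_inc) blast

lemma T_polyhedron_eq_0:
  assumes "t \<in> T_polyhedron n" "e \<notin> E\<^sub>K n"
  shows "t e = 0"
  using assms(1) unfolding T_polyhedron_def
proof (rule hull_induct)
  show "s e = 0" if "s \<in> {multi_incidence J | J. tour n J}" for s
    using that assms(2) by (auto simp: tour_def multi_incidence_def count_eq_zero_iff)
  show "convex {s :: nat set \<Rightarrow> real. s e = 0}" by (rule convexI) simp
qed

lemma tour_add_even_copies:
  assumes "tour n J" "e \<in> E\<^sub>K n"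
  shows "tour n (J + replicate_mset (2 * k) e)"
proof -
  have "connected_graph (V\<^sub>K n) (set_mset (J + replicate_mset (2 * k) e))"
    using assms(1) connected_graph_mono[of _ "set_mset J"] unfolding tour_def by simp
  moreover have "even (size {#d \<in># replicate_mset (2 * k) e. v \<in> d#})" for v
    by (induction k) auto
  ultimately show ?thesis using assms unfolding tour_def by auto
qed

lemma T_polyhedron_add_edge:
  assumes "e \<in> E\<^sub>K n" "0 \<le> r" "t \<in> T_polyhedron n"
  shows "r *\<^sub>R indicator {e} + t \<in> T_polyhedron n"
  using assms(3)[unfolded T_polyhedron_def] convex_T_polyhedron
proof (rule convex_hull_translate_mem)
  fix s assume "s \<in> {multi_incidence J | J. tour n J}"
  then obtain J where J: "tour n J" "s = multi_incidence J" by blast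
  obtain k :: nat where k: "r < k" using reals_Archimedean2 by blast
  let ?s = "multi_incidence (J + replicate_mset (2 * k) e)" and ?a = "r / (2 * real k)"
  have "0 \<le> ?a" "?a \<le> 1" using assms(2) k by (auto simp: field_simps)
  then have "(1 - ?a) *\<^sub>R s + ?a *\<^sub>R ?s \<in> T_polyhedron n"
    using J assms(1)
    by (intro convexD[OF convex_T_polyhedron])
      (auto intro: multi_incidence_in_T_polyhedron tour_add_even_copies)
  moreover have "(1 - ?a) *\<^sub>R s + ?a *\<^sub>R ?s = r *\<^sub>R indicator {e} + s"
    using assms(2) k unfolding J(2)
    by (auto simp: fun_eq_iff multi_incidence_def indicator_def field_simps)
  ultimately show "r *\<^sub>R indicator {e} + s \<in> T_polyhedron n" by simp
qed

lemma T_polyhedron_upward_closed: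
  assumes t: "t \<in> T_polyhedron n" and le: "\<And>e. e \<in> E\<^sub>K n \<Longrightarrow> t e \<le> s e"
    and s_zero: "\<And>e. e \<notin> E\<^sub>K n \<Longrightarrow> s e = 0"
  shows "s \<in> T_polyhedron n"
proof -
  have "override_on t s X \<in> T_polyhedron n" if "finite X" "X \<subseteq> E\<^sub>K n" for X
    using that
  proof (induction X rule: finite_induct)
    case empty
    then show ?case using t by simp
  next
    case (insert e X)
    have "(s e - t e) *\<^sub>R indicator {e} + override_on t s X \<in> T_polyhedron n"
      using insert le by (intro T_polyhedron_add_edge) auto
    moreover have "(s e - t e) *\<^sub>R indicator {e} + override_on t s X = override_on t s (insert e X)"
      using insert.hyps by (auto simp: fun_eq_iff indicator_def override_on_def)
    ultimately show ?case by simp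
  qed
  from this[OF complete_graph.finite_E order_refl]
  have "override_on t s (E\<^sub>K n) \<in> T_polyhedron n" .
  moreover have "override_on t s (E\<^sub>K n) = s"
    using T_polyhedron_eq_0[OF t] s_zero by (auto simp: fun_eq_iff override_on_def)
  ultimately show ?thesis by simp
qed

lemma tour_mset_set_plus_join:
  assumes "F \<subseteq> E\<^sub>K n" "connected_graph (V\<^sub>K n) F" "J \<in> joins (E\<^sub>K n) (odd_vertices F)"
  shows "tour n (mset_set F + mset_set J)"
proof -
  have JE: "J \<subseteq> E\<^sub>K n" and odd: "odd_vertices F = odd_vertices J"
    using joinsD[OF assms(3)] by simp_all
  have fin: "finite F" "finite J" using assms(1) JE complete_graph.finite_edges by blast+
  have "even (size {#e \<in># mset_set F + mset_set J. v \<in> e#})" for v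
    using odd fin by (auto simp: odd_vertices_def filter_mset_mset_set set_eq_iff)
  moreover have "connected_graph (V\<^sub>K n) (F \<union> J)" using connected_graph_mono[OF assms(2)] by auto
  ultimately show ?thesis using assms(1) JE fin by (auto simp: tour_def)
qed

lemma indicator_plus_join_in_T_polyhedron:
  assumes "F \<subseteq> E\<^sub>K n" "connected_graph (V\<^sub>K n) F" "J \<in> joins (E\<^sub>K n) (odd_vertices F)"
  shows "indicator F + indicator J \<in> T_polyhedron n"
proof -
  have "finite F" "finite J"
    using assms(1) joins_subset[OF assms(3)] complete_graph.finite_edges by blast+
  then have "multi_incidence (mset_set F + mset_set J) = indicator F + indicator J"
    by (auto simp: fun_eq_iff multi_incidence_def count_mset_set' indicator_def)
  then show ?thesis
    using multi_incidence_in_T_polyhedron[OF tour_mset_set_plus_join[OF assms]] by simp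
qed

lemma indicator_plus_cut_cover_in_T_polyhedron:
  assumes F: "F \<subseteq> E\<^sub>K n" "connected_graph (V\<^sub>K n) F"
    and y: "complete_graph.fractional_cut_cover n (odd_vertices F) y"
    and y_zero: "\<And>e. e \<notin> E\<^sub>K n \<Longrightarrow> y e = 0"
  shows "indicator F + y \<in> T_polyhedron n"
proof -
  have "F \<in> joins (E\<^sub>K n) (odd_vertices F)" using F(1) by (simp add: joinsI)
  then obtain z where z: "z \<in> convex hull (indicator ` joins (E\<^sub>K n) (odd_vertices F))"
      "\<forall>e\<in>E\<^sub>K n. z e \<le> y e"
    using complete_graph.edmonds_johnson[OF _ y] by blast
  have "indicator F + z \<in> T_polyhedron n"
    using z(1) convex_T_polyhedron
    by (rule convex_hull_translate_mem) (auto intro: indicator_plus_join_in_T_polyhedron[OF F])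
  then show ?thesis
  proof (rule T_polyhedron_upward_closed)
    show "(indicator F + z) e \<le> (indicator F + y) e" if "e \<in> E\<^sub>K n" for e
      using z(2) that by simp
    show "(indicator F + y) e = 0" if "e \<notin> E\<^sub>K n" for e
      using y_zero that F(1) by (auto simp: indicator_def)
  qed
qed

subsection \<open>One-trees and Hamiltonian cycles\<close>

lemma one_tree_connected:
  assumes "one_tree n F"
  shows "connected_graph (V\<^sub>K n) F"
proof -
  have "card (F \<inter> cut_edges (E\<^sub>K n) {1}) \<noteq> 0" using assms by (simp add: one_tree_def)
  then obtain e where e: "e \<in> F" "e \<in> cut_edges (E\<^sub>K n) {1}"
    by (metis Int_iff card.empty ex_in_conv)
  from e(2) order_refl obtain a b where ab: "e = {a, b}" "a \<noteq> b" "e \<in> E\<^sub>K n" "a \<in> {1}" "b \<notin> {1}"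
    by (rule complete_graph.cut_edgesE)
  then have b: "b \<in> V\<^sub>K n - {1}" using complete_graph.Union_edges[OF order_refl] ab(1,3,5) by blast
  have "connected_graph (V\<^sub>K n - {1}) (F - cut_edges (E\<^sub>K n) {1})"
    using assms by (simp add: one_tree_def spanning_tree_on_def)
  then have tree: "connected_graph (V\<^sub>K n - {1}) F" by (rule connected_graph_mono) auto
  have "reachable F b v" if v: "v \<in> V\<^sub>K n" for v
  proof (cases "v = 1")
    case True
    then have "{b, v} = e" using ab(1,4) by (simp add: insert_commute)
    then have "{b, v} \<in> F" using e(1) by simp
    then show ?thesis by (rule reachable_step[OF reachable_refl])
  next
    case False
    then show ?thesis using tree b v by (simp add: connected_graph_iff_reachable)
  qed
  then show ?thesis by (rule connected_graphI_root)
qed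

lemma closed_walk_connected: "connected_graph (set vs) (closed_walk_edges vs)"
proof (rule connected_graphI_root)
  have "reachable (closed_walk_edges vs) (vs ! 0) (vs ! i)" if "i < length vs" for i
    using that
  proof (induction i)
    case (Suc i)
    then have "{vs ! i, vs ! Suc i} \<in> closed_walk_edges vs"
      by (force simp: closed_walk_edges_def)
    then show ?case using Suc by (auto intro: reachable_step)
  qed simp
  then show "reachable (closed_walk_edges vs) (vs ! 0) v" if "v \<in> set vs" for v
    using that by (metis in_set_conv_nth)
qed

definition closed_walk_edge :: "'a list \<Rightarrow> nat \<Rightarrow> 'a set"
  where "closed_walk_edge vs i = {vs ! i, vs ! (Suc i mod length vs)}"

lemma closed_walk_edges_eq_image: "closed_walk_edges vs = closed_walk_edge vs ` {..<length vs}"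
  by (auto simp: closed_walk_edges_def closed_walk_edge_def)

lemma inj_on_Suc_mod: "inj_on (\<lambda>i. Suc i mod m) {..<m}"
  by (rule inj_onI) (auto simp: mod_Suc split: if_splits)

lemma inj_on_closed_walk_edge:
  assumes "3 \<le> length vs" "distinct vs"
  shows "inj_on (closed_walk_edge vs) {..<length vs}"
proof (rule inj_onI)
  let ?m = "length vs"
  fix i j assume ij: "i \<in> {..<?m}" "j \<in> {..<?m}" "closed_walk_edge vs i = closed_walk_edge vs j"
  have "Suc k mod ?m < ?m" for k using assms(1) by (intro mod_less_divisor) linarith
  then have "i = j \<or> (i = Suc j mod ?m \<and> Suc i mod ?m = j)"
    using ij nth_eq_iff_index_eq[OF assms(2)] unfolding closed_walk_edge_def doubleton_eq_iff
    by auto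
  then show "i = j" using ij(1,2) assms(1) by (auto simp: mod_Suc split: if_splits)
qed

text \<open>Each occurrence of a vertex as the tail of a step is paired with one as the head of a step.\<close>

lemma odd_vertices_closed_walk:
  assumes "3 \<le> length vs" "distinct vs"
  shows "odd_vertices (closed_walk_edges vs) = {}"
proof -
  let ?m = "length vs" and ?next = "\<lambda>i. Suc i mod length vs"
  have next_less: "?next i < ?m" for i using assms(1) by (intro mod_less_divisor) linarith
  have "even (card {e \<in> closed_walk_edges vs. v \<in> e})" for v
  proof -
    let ?tail = "{i \<in> {..<?m}. vs ! i = v}" and ?head = "{i \<in> {..<?m}. vs ! ?next i = v}"
    have "{e \<in> closed_walk_edges vs. v \<in> e} = closed_walk_edge vs ` (?tail \<union> ?head)"
      by (auto simp: closed_walk_edges_eq_image closed_walk_edge_def)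
    moreover have "inj_on (closed_walk_edge vs) (?tail \<union> ?head)"
      by (rule inj_on_subset[OF inj_on_closed_walk_edge[OF assms]]) auto
    moreover have "?tail \<inter> ?head = {}"
    proof -
      have "vs ! ?next i \<noteq> vs ! i" if "i < ?m" for i
        using that assms(1) next_less
        by (subst nth_eq_iff_index_eq[OF assms(2)]) (auto simp: mod_Suc)
      then show ?thesis by auto
    qed
    moreover have "card ?head = card ?tail"
    proof -
      have "?next ` {..<?m} = {..<?m}"
        using next_less by (intro endo_inj_surj inj_on_Suc_mod) auto
      then have "?tail = {i \<in> ?next ` {..<?m}. vs ! i = v}" by simp
      also have "\<dots> = ?next ` ?head" by auto
      finally have "?tail = ?next ` ?head" .
      moreover have "inj_on ?next ?head" by (rule inj_on_subset[OF inj_on_Suc_mod]) auto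
      ultimately show ?thesis by (simp only: card_image)
    qed
    ultimately show ?thesis by (simp add: card_image card_Un_disjoint)
  qed
  then show ?thesis by (auto simp: odd_vertices_def)
qed

lemma hamiltonian_cycleD:
  assumes "hamiltonian_cycle V E H"
  shows hamiltonian_cycle_subset: "H \<subseteq> E"
    and hamiltonian_cycle_connected: "connected_graph V H"
    and odd_vertices_hamiltonian_cycle: "odd_vertices H = {}"
  using assms closed_walk_connected odd_vertices_closed_walk
  unfolding hamiltonian_cycle_def cycle_in_def by blast+

subsection \<open>Half-integer points with a Hamiltonian support\<close>

lemma half_card_le_sum:
  fixes x :: "'e \<Rightarrow> real"
  assumes "\<And>e. e \<in> C \<Longrightarrow> x e = 1/2 \<or> x e = 1"
  shows "card C / 2 \<le> sum x C"
proof -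
  have "(\<Sum>e\<in>C. 1/2) \<le> sum x C" using assms by (intro sum_mono) force
  then show ?thesis by simp
qed

text \<open>Only \<open>card (C \<inter> H) = 4\<close> is delicate: for smaller values the cut constraint suffices, for
  larger ones \<open>card (C \<inter> H) \<le> card C\<close> does.\<close>

lemma half_integer_cut_bound:
  fixes x :: "'e \<Rightarrow> real"
  assumes "finite C" and h_even: "even (card (C \<inter> H))"
    and half: "\<And>e. e \<in> C \<Longrightarrow> x e = 1/2 \<or> x e = 1" and cut: "2 \<le> sum x C"
    and noncritical: "\<not> (card C = 4 \<and> (\<forall>e\<in>C. x e = 1/2 \<and> e \<in> H))"
  shows "1 \<le> 2/3 * sum x C - 1/6 * real (card (C \<inter> H))"
proof -
  have h_le: "card (C \<inter> H) \<le> card C" using assms(1) by (simp add: card_mono)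
  have half_card: "card C / 2 \<le> sum x C" using half by (rule half_card_le_sum)
  consider "card (C \<inter> H) \<le> 2" | "6 \<le> card (C \<inter> H)" | "card (C \<inter> H) = 4" "5 \<le> card C"
    | "card (C \<inter> H) = 4" "card C = 4"
    using h_even h_le by fastforce
  then show ?thesis
  proof cases
    case 1
    then show ?thesis using cut by linarith
  next
    case 2
    then show ?thesis using half_card h_le by linarith
  next
    case 3
    then show ?thesis using half_card by linarith
  next
    case 4
    then have "C \<inter> H = C" using assms(1) by (intro card_subset_eq) auto
    then obtain e where e: "e \<in> C" "x e = 1" using noncritical half 4(2) by blast
    have "card (C - {e}) / 2 \<le> sum x (C - {e})" using half by (intro half_card_le_sum) blast
    then have "5/2 \<le> sum x C" using e 4(2) assms(1) by (simp add: sum.remove)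
    then show ?thesis using 4(1) by simp
  qed
qed

locale hamiltonian_half_integer_point =
  fixes n :: nat and x :: "nat set \<Rightarrow> real" and H :: "nat set set"
  assumes x_in_S: "x \<in> S_polytope n" and x_half_integer: "half_integer n x"
    and H_cycle: "hamiltonian_cycle (V\<^sub>K n) (support_edges n x) H"
begin

abbreviation G :: "nat set set"
  where "G \<equiv> support_edges n x"

definition critical_cut :: "nat set \<Rightarrow> bool"
  where "critical_cut S \<longleftrightarrow> S \<noteq> {} \<and> S \<subset> V\<^sub>K n \<and> card (cut_edges G S) = 4 \<and>
    (\<forall>e\<in>cut_edges G S. x e = 1/2 \<and> e \<in> H)"

definition join_cover :: "nat set \<Rightarrow> real"
  where "join_cover = (2/3) *\<^sub>R x - (1/6) *\<^sub>R indicator H"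

lemma G_subset: "G \<subseteq> E\<^sub>K n"
  by (auto simp: support_edges_def)

lemma H_subset: "H \<subseteq> G"
  using H_cycle by (rule hamiltonian_cycle_subset)

lemma H_edges: "H \<subseteq> E\<^sub>K n"
  using H_subset G_subset by (rule subset_trans)

lemma x_half: "e \<in> G \<Longrightarrow> x e = 1/2 \<or> x e = 1"
  using x_half_integer by (auto simp: half_integer_def support_edges_def)

lemma x_zero: "e \<notin> G \<Longrightarrow> x e = 0"
  using x_in_S x_half_integer
  by (cases "e \<in> E\<^sub>K n") (auto simp: S_polytope_def half_integer_def support_edges_def)

lemma join_cover_zero: "e \<notin> G \<Longrightarrow> join_cover e = 0"
  using x_zero H_subset by (auto simp: join_cover_def indicator_def)

lemma join_cover_nonneg: "0 \<le> join_cover e"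
  using x_half[of e] join_cover_zero[of e]
  by (cases "e \<in> G") (auto simp: join_cover_def indicator_def)

lemma sum_cut_eq_sum_support_cut:
  assumes "\<And>e. e \<notin> G \<Longrightarrow> f e = (0 :: real)"
  shows "sum f (cut_edges (E\<^sub>K n) S) = sum f (cut_edges G S)"
proof (rule sum.mono_neutral_right)
  show "finite (cut_edges (E\<^sub>K n) S)" by (rule finite_cut_edges[OF complete_graph.finite_E])
  show "cut_edges G S \<subseteq> cut_edges (E\<^sub>K n) S" by (rule cut_edges_mono[OF G_subset])
  show "\<forall>e\<in>cut_edges (E\<^sub>K n) S - cut_edges G S. f e = 0"
    unfolding cut_edges_Int_right[OF G_subset, symmetric] using assms by blast
qed

lemma join_cover_cut_ge_1:
  assumes S: "S \<noteq> {}" "S \<subset> V\<^sub>K n" and "\<not> critical_cut S"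
  shows "1 \<le> sum join_cover (cut_edges (E\<^sub>K n) S)"
proof -
  let ?C = "cut_edges G S"
  have fin: "finite ?C" using complete_graph.finite_edges[OF G_subset] by (rule finite_cut_edges)
  have cut_H: "?C \<inter> H = cut_edges H S"
    using cut_edges_Int_right[OF H_subset] by (simp add: Int_commute)
  have "even (card (cut_edges H S))"
    using complete_graph.even_card_Int_odd_vertices_iff[OF H_edges, of S]
      odd_vertices_hamiltonian_cycle[OF H_cycle] by simp
  moreover have "2 \<le> sum x (cut_edges (E\<^sub>K n) S)" using x_in_S S unfolding S_polytope_def by blast
  then have "2 \<le> sum x ?C" using sum_cut_eq_sum_support_cut[OF x_zero] by simp
  moreover have "\<not> (card ?C = 4 \<and> (\<forall>e\<in>?C. x e = 1/2 \<and> e \<in> H))"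
    using assms unfolding critical_cut_def by blast
  moreover have "x e = 1/2 \<or> x e = 1" if "e \<in> ?C" for e
    using that cut_edges_subset x_half by blast
  ultimately have "1 \<le> 2/3 * sum x ?C - 1/6 * real (card (?C \<inter> H))"
    using fin unfolding cut_H[symmetric] by (intro half_integer_cut_bound)
  also have "\<dots> = sum join_cover ?C"
    using fin
    by (simp add: join_cover_def sum_subtractf sum_distrib_left indicator_def sum.If_cases
        flip: sum_divide_distrib)
  also have "\<dots> = sum join_cover (cut_edges (E\<^sub>K n) S)"
    using sum_cut_eq_sum_support_cut[OF join_cover_zero] by simp
  finally show ?thesis .
qed

lemma join_cover_plus_one_tree_in_T_polyhedron:
  assumes F: "one_tree n F" "F \<subseteq> G"
    and F_even: "\<And>S. critical_cut S \<Longrightarrow> even (card (F \<inter> cut_edges G S))"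
  shows "join_cover + indicator F \<in> T_polyhedron n"
proof -
  have FE: "F \<subseteq> E\<^sub>K n" using F(2) G_subset by (rule subset_trans)
  have "1 \<le> sum join_cover (cut_edges (E\<^sub>K n) S)"
    if S: "S \<subseteq> V\<^sub>K n" "odd (card (S \<inter> odd_vertices F))" for S
  proof (rule join_cover_cut_ge_1)
    show "S \<noteq> {}" using S(2) by auto
    have "V\<^sub>K n \<inter> odd_vertices F = odd_vertices F"
      using complete_graph.odd_vertices_subset[OF FE] by blast
    then have "S \<noteq> V\<^sub>K n" using S(2) complete_graph.even_card_odd_vertices[OF FE] by metis
    then show "S \<subset> V\<^sub>K n" using S(1) by blast
    have "odd (card (F \<inter> cut_edges G S))"
      using S(2) complete_graph.even_card_Int_odd_vertices_iff[OF FE] cut_edges_Int_right[OF F(2)]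
      by metis
    then show "\<not> critical_cut S" using F_even by blast
  qed
  then have "complete_graph.fractional_cut_cover n (odd_vertices F) join_cover"
    using join_cover_nonneg by (simp add: complete_graph.fractional_cut_cover_def)
  moreover have "join_cover e = 0" if "e \<notin> E\<^sub>K n" for e using join_cover_zero G_subset that by blast
  ultimately have "indicator F + join_cover \<in> T_polyhedron n"
    using FE one_tree_connected[OF F(1)] by (intro indicator_plus_cut_cover_in_T_polyhedron)
  then show ?thesis by (simp add: add.commute)
qed

text \<open>As \<open>x\<close> vanishes outside \<open>G\<close>, only 1-trees contained in \<open>G\<close> occur in the convex combination.\<close>

lemma join_cover_plus_point_in_T_polyhedron:
  assumes "x \<in> convex hull {indicator F | F. one_tree n F \<and>
    (\<forall>S. critical_cut S \<longrightarrow> even (card (F \<inter> cut_edges G S)))}" (is "_ \<in> convex hull ?A")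
  shows "join_cover + x \<in> T_polyhedron n"
proof (rule convex_hull_translate_mem)
  show "x \<in> convex hull {s \<in> ?A. \<forall>e\<in>-G. s e = 0}"
    using assms x_zero by (intro convex_hull_mem_vanishing) auto
  show "join_cover + s \<in> T_polyhedron n" if s: "s \<in> {s \<in> ?A. \<forall>e\<in>-G. s e = 0}" for s
  proof -
    obtain F where F: "s = indicator F" "one_tree n F"
        "\<forall>S. critical_cut S \<longrightarrow> even (card (F \<inter> cut_edges G S))"
      using s by blast
    have "F \<subseteq> G" using s F(1) by (auto simp: indicator_eq_0_iff)
    then show ?thesis
      unfolding F(1) using F(2,3) by (intro join_cover_plus_one_tree_in_T_polyhedron) auto
  qed
qed (rule convex_T_polyhedron)

lemma indicator_H_in_T_polyhedron: "indicator H \<in> T_polyhedron n"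
proof -
  have "{} \<in> joins (E\<^sub>K n) (odd_vertices H)"
    using odd_vertices_hamiltonian_cycle[OF H_cycle] by (simp add: joinsI)
  from indicator_plus_join_in_T_polyhedron[OF H_edges hamiltonian_cycle_connected[OF H_cycle] this]
  show ?thesis by (simp add: plus_fun_def)
qed

end

theorem theorem7:
  fixes n :: nat and x :: "nat set \<Rightarrow> real" and H :: "nat set set"
  assumes "n \<ge> 3"
    and "x \<in> S_polytope n"
    and "half_integer n x"
    and A: "hamiltonian_cycle (V\<^sub>K n) (support_edges n x) H"
    and B: "x \<in> convex hull {indicator F | F. one_tree n F \<and>
          (\<forall>S. S \<noteq> {} \<and> S \<subset> V\<^sub>K n \<and>
               card (cut_edges (support_edges n x) S) = 4 \<and>
               (\<forall>e\<in>cut_edges (support_edges n x) S. x e = 1/2 \<and> e \<in> H) \<longrightarrow>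
               even (card (F \<inter> cut_edges (support_edges n x) S)))}"
  shows "(10/7) *\<^sub>R x \<in> T_polyhedron n"
proof -
  interpret hamiltonian_half_integer_point n x H
    using assms by unfold_locales
  have "join_cover + x \<in> T_polyhedron n"
    using B by (intro join_cover_plus_point_in_T_polyhedron) (simp add: critical_cut_def)
  then have "(6/7) *\<^sub>R (join_cover + x) + (1/7) *\<^sub>R indicator H \<in> T_polyhedron n"
    using indicator_H_in_T_polyhedron by (intro convexD[OF convex_T_polyhedron]) simp_all
  moreover have "(6/7) *\<^sub>R (join_cover + x) + (1/7) *\<^sub>R indicator H = (10/7) *\<^sub>R x"
    by (auto simp: fun_eq_iff join_cover_def field_simps)
  ultimately show ?thesis by simp
qed

end
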